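(* Let $\sigma=\{\pi_i \mid i\in I\}$ be a partition of the set of all primes into mutually disjoint subsets and let $G$ be a finite group. Then the set of all $\sigma^{(3)}$-permutable subgroups of $G$ forms a sublattice of the lattice of all subgroups of $G$; that is, if $A$ and $B$ are $\sigma^{(3)}$-permutable subgroups of $G$, then $A\cap B$ and $\langle A,B\rangle$ are $\sigma^{(3)}$-permutable subgroups of $G$.
   Context: All groups are finite. $\sigma=\{\pi_i \mid i\in I\}$ is a partition of the set $\mathbb{P}$ of all primes: $\pi_i\cap\pi_j=\emptyset$ for $i\neq j$ and $\bigcup_{i\in I}\pi_i=\mathbb{P}$. We write $P^x=x^{-1}Px$. In the lattice of all subgroups of $G$, the meet of $A$ and $B$ is $A\cap B$ and the join is $\langle A,B\rangle$. For a set of primes $\pi$, $\mathfrak{G}_\pi$ denotes the class of all finite $\pi$-groups. A subgroup $P$ of $G$ is a $\mathfrak{G}_\pi$-projector of $G$ if, for every normal subgroup $N$ of $G$, $PN/N$ is $\mathfrak{G}_\pi$-maximal in $G/N$, i.e. $PN/N$ is a $\pi$-subgroup of $G/N$ not properly contained in any other $\pi$-subgroup of $G/N$. (Such projectors exist in every finite group.) A subgroup $H$ of $G$ is called $\sigma^{(3)}$-permutable if for every $\pi_i\in\sigma$ there is a $\mathfrak{G}_{\pi_i}$-projector $P$ of $G$ such that $HP^x=P^xH$ for all $x\in G$. *)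

theory Defs
  imports
    "HOL-Algebra.Coset"
    "HOL-Algebra.Generated_Groups"
    "HOL-Computational_Algebra.Primes"
    "HOL-Library.Disjoint_Sets"
begin

text \<open>As in the informal notion, an empty cell \<open>\<pi> i\<close> is not excluded; for such a cell the
  only \<open>\<pi> i\<close>-group is the trivial one.\<close>

definition prime_partition :: "'i set \<Rightarrow> ('i \<Rightarrow> nat set) \<Rightarrow> bool" where
  "prime_partition I \<pi> \<longleftrightarrow> disjoint_family_on \<pi> I \<and> (\<Union>i\<in>I. \<pi> i) = {p. prime p}"

definition pi_group :: "nat set \<Rightarrow> ('a, 'b) monoid_scheme \<Rightarrow> bool" where
  "pi_group \<pi> G \<longleftrightarrow> group G \<and> finite (carrier G) \<and> (\<forall>p. prime p \<and> p dvd order G \<longrightarrow> p \<in> \<pi>)"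

definition pi_subgroup :: "nat set \<Rightarrow> ('a, 'b) monoid_scheme \<Rightarrow> 'a set \<Rightarrow> bool" where
  "pi_subgroup \<pi> G H \<longleftrightarrow> subgroup H G \<and> pi_group \<pi> (G\<lparr>carrier := H\<rparr>)"

definition pi_maximal :: "nat set \<Rightarrow> ('a, 'b) monoid_scheme \<Rightarrow> 'a set \<Rightarrow> bool" where
  "pi_maximal \<pi> G M \<longleftrightarrow> pi_subgroup \<pi> G M \<and> \<not> (\<exists>K. pi_subgroup \<pi> G K \<and> M \<subset> K)"

text \<open>The subset \<open>PN/N\<close> of \<open>G/N\<close> is the set of right cosets of \<open>N\<close> in the group \<open>PN\<close>.\<close>

definition pi_projector :: "nat set \<Rightarrow> ('a, 'b) monoid_scheme \<Rightarrow> 'a set \<Rightarrow> bool" where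
  "pi_projector \<pi> G P \<longleftrightarrow> subgroup P G \<and>
    (\<forall>N. N \<lhd> G \<longrightarrow>
      pi_maximal \<pi> (G Mod N) (carrier (G\<lparr>carrier := P <#>\<^bsub>G\<^esub> N\<rparr> Mod N)))"

definition conj_subgroup :: "('a, 'b) monoid_scheme \<Rightarrow> 'a set \<Rightarrow> 'a \<Rightarrow> 'a set" where
  "conj_subgroup G P x = (inv\<^bsub>G\<^esub> x <#\<^bsub>G\<^esub> P) #>\<^bsub>G\<^esub> x"

definition sigma3_permutable :: "nat set set \<Rightarrow> ('a, 'b) monoid_scheme \<Rightarrow> 'a set \<Rightarrow> bool" where
  "sigma3_permutable \<sigma> G H \<longleftrightarrow> subgroup H G \<and>
    (\<forall>\<pi>\<in>\<sigma>. \<exists>P. pi_projector \<pi> G P \<and>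
      (\<forall>x\<in>carrier G. H <#>\<^bsub>G\<^esub> conj_subgroup G P x = conj_subgroup G P x <#>\<^bsub>G\<^esub> H))"

end

theory Submission
  imports Defs "HOL-Algebra.Multiplicative_Group" "HOL-Algebra.Sylow"
begin

text \<open>
  The definition of \<open>\<sigma>\<^sup>(\<^sup>3\<^sup>)\<close>-permutability lets the projector depend on the subgroup, and the
  \<open>\<pi>\<close>-projectors of a group need not be conjugate. Moreover, permuting with a given subgroup is in
  general not inherited by intersections. Both difficulties disappear once permutability is
  translated into a condition that mentions no projector.

  For a cell \<open>\<pi>\<close> let \<open>L\<close> be the normal subgroup of \<open>G\<close> generated by all elements whose order is a
  power of a prime in \<open>\<pi>\<close>; it contains every \<open>\<pi>\<close>-subgroup. Call \<open>H\<close> sandwiched at \<open>\<pi>\<close> if there are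
  subgroups \<open>R \<subseteq> H \<subseteq> K\<close>, both normalized by \<open>L\<close>, such that every element of \<open>K\<close> has a power with
  a \<open>\<pi>\<close>-number as exponent in \<open>R\<close>. This condition is visibly closed under intersections
  (\<open>sandwiched_Int\<close>), and two implications connect it with permutability.

  Suppose \<open>H\<close> permutes, in each cell, with all conjugates of a projector \<open>P\<close>. Among the subgroups
  above \<open>H\<close> that permute with all conjugates of \<open>P\<close> and in which \<open>H\<close> has \<open>\<pi>\<close>-index, take a largest
  one, \<open>K\<close>. For \<open>b\<close> in a conjugate \<open>Q\<close> of \<open>P\<close> the group generated by \<open>K\<close> and its conjugate under \<open>b\<close>
  lies in \<open>KQ\<close> and is of the same kind, so \<open>b\<close> normalizes \<open>K\<close> (\<open>permuting_overgroup\<close>, after Kegel).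
  Hence the normal closure of \<open>P\<close>, and so \<open>L\<close>, normalizes \<open>K\<close>. Let \<open>x\<close> be an element of \<open>K\<close> of
  \<open>q\<close>-power order with \<open>q\<close> in another cell \<open>\<tau>\<close>, and let \<open>M\<close> be the overgroup constructed for \<open>\<tau>\<close>.
  The indices of \<open>H\<close> in \<open>K\<close> and in \<open>M\<close> are coprime, so \<open>H = K \<inter> M\<close> is normalized by \<open>x\<close>; then
  the index of \<open>H\<close> in \<open>H\<langle>x\<rangle>\<close> divides both a \<open>\<pi>\<close>-number and a power of \<open>q\<close>, and \<open>x \<in> H\<close>. The
  elements \<open>x\<close> of this kind generate the lower group \<open>R\<close> (\<open>sandwiched_if_permuting\<close>).

  Conversely, a sandwiched \<open>H\<close> permutes with \<^emph>\<open>every\<close> projector \<open>P\<close>, because \<open>HP = RP\<close>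
  (\<open>sandwiched_permutes\<close>). This rests on \<open>projector_covers_section\<close>: if \<open>T \<subseteq> V\<close> are normal
  subgroups of \<open>L\<close> and \<open>V/T\<close> is a \<open>\<pi>\<close>-group, then \<open>V \<subseteq> PT\<close>. When \<open>T\<close> is normal in \<open>G\<close> this is the
  maximality of \<open>P\<close> modulo \<open>T\<close>; the general case is reduced to it by induction, passing from \<open>T\<close> to
  its core in \<open>G\<close>.

  So \<open>A \<inter> B\<close> permutes with every projector, and so does the join, since it permutes with whatever
  \<open>A\<close> and \<open>B\<close> both permute with.
\<close>

section \<open>Numbers with prescribed prime divisors\<close>

definition pi_number :: "nat set \<Rightarrow> nat \<Rightarrow> bool" where
  "pi_number \<pi> m \<longleftrightarrow> m > 0 \<and> (\<forall>p. prime p \<and> p dvd m \<longrightarrow> p \<in> \<pi>)"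

lemma pi_number_mult: "pi_number \<pi> m \<Longrightarrow> pi_number \<pi> n \<Longrightarrow> pi_number \<pi> (m * n)"
  by (auto simp: pi_number_def prime_dvd_mult_iff)

lemma pi_number_dvd: "pi_number \<pi> m \<Longrightarrow> d dvd m \<Longrightarrow> pi_number \<pi> d"
  by (auto simp: pi_number_def dest: dvd_trans intro: Nat.gr0I)

lemma pi_number_1 [simp]: "pi_number \<pi> (Suc 0)"
  by (auto simp: pi_number_def)

lemma pi_number_prime_power: "prime q \<Longrightarrow> q \<in> \<pi> \<Longrightarrow> pi_number \<pi> (q ^ n)"
  by (auto simp: pi_number_def prime_gt_0_nat dest: prime_dvd_power primes_dvd_imp_eq)

lemma pi_number_coprime:
  assumes "pi_number \<pi> m" "pi_number \<tau> n" "\<pi> \<inter> \<tau> = {}"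
  shows "coprime m n"
proof (rule ccontr)
  assume "\<not> coprime m n"
  then have "gcd m n \<noteq> 1" by (simp add: coprime_iff_gcd_eq_1)
  then obtain p where "prime p" "p dvd gcd m n" using prime_factor_nat by blast
  then show False using assms by (auto simp: pi_number_def)
qed

section \<open>Conjugation, normalization and products of subgroups\<close>

definition conjugate :: "('a, 'b) monoid_scheme \<Rightarrow> 'a \<Rightarrow> 'a \<Rightarrow> 'a" where
  "conjugate G g x = g \<otimes>\<^bsub>G\<^esub> x \<otimes>\<^bsub>G\<^esub> inv\<^bsub>G\<^esub> g"

definition normalizes :: "('a, 'b) monoid_scheme \<Rightarrow> 'a set \<Rightarrow> 'a set \<Rightarrow> bool" where
  "normalizes G L X \<longleftrightarrow> (\<forall>l\<in>L. \<forall>x\<in>X. conjugate G l x \<in> X)"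

context group
begin

lemma mult_inv_cancel_left [simp]:
  "\<lbrakk>x \<in> carrier G; y \<in> carrier G\<rbrakk> \<Longrightarrow> x \<otimes> (inv x \<otimes> y) = y"
  "\<lbrakk>x \<in> carrier G; y \<in> carrier G\<rbrakk> \<Longrightarrow> inv x \<otimes> (x \<otimes> y) = y"
  by (simp_all flip: m_assoc)

lemma conjugate_closed [simp, intro]: "g \<in> carrier G \<Longrightarrow> x \<in> carrier G \<Longrightarrow> conjugate G g x \<in> carrier G"
  by (simp add: conjugate_def)

lemma conjugate_mult:
  "\<lbrakk>g \<in> carrier G; x \<in> carrier G; y \<in> carrier G\<rbrakk>
    \<Longrightarrow> conjugate G g (x \<otimes> y) = conjugate G g x \<otimes> conjugate G g y"
  by (simp add: conjugate_def m_assoc)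

lemma conjugate_one [simp]: "g \<in> carrier G \<Longrightarrow> conjugate G g \<one> = \<one>"
  by (simp add: conjugate_def)

lemma one_conjugate [simp]: "x \<in> carrier G \<Longrightarrow> conjugate G \<one> x = x"
  by (simp add: conjugate_def)

lemma conjugate_conjugate:
  "\<lbrakk>g \<in> carrier G; h \<in> carrier G; x \<in> carrier G\<rbrakk>
    \<Longrightarrow> conjugate G g (conjugate G h x) = conjugate G (g \<otimes> h) x"
  by (simp add: conjugate_def m_assoc inv_mult_group)

lemma conjugate_inv_cancel [simp]:
  "\<lbrakk>g \<in> carrier G; x \<in> carrier G\<rbrakk> \<Longrightarrow> conjugate G g (conjugate G (inv g) x) = x"
  "\<lbrakk>g \<in> carrier G; x \<in> carrier G\<rbrakk> \<Longrightarrow> conjugate G (inv g) (conjugate G g x) = x"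
  by (simp_all add: conjugate_conjugate)

lemma conjugate_hom: "g \<in> carrier G \<Longrightarrow> group_hom G G (conjugate G g)"
  by unfold_locales (auto simp: hom_def conjugate_mult)

lemma conjugate_inv:
  "\<lbrakk>g \<in> carrier G; x \<in> carrier G\<rbrakk> \<Longrightarrow> conjugate G g (inv x) = inv (conjugate G g x)"
  by (simp add: group_hom.hom_inv[OF conjugate_hom])

lemma conjugate_pow:
  "\<lbrakk>g \<in> carrier G; x \<in> carrier G\<rbrakk> \<Longrightarrow> conjugate G g (x [^] (n::nat)) = conjugate G g x [^] n"
  by (induction n) (auto simp: conjugate_mult)

lemma conjugate_subgroup: "g \<in> carrier G \<Longrightarrow> subgroup H G \<Longrightarrow> subgroup (conjugate G g ` H) G"
  by (rule group_hom.subgroup_img_is_subgroup[OF conjugate_hom])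

lemma inj_conjugate: "g \<in> carrier G \<Longrightarrow> inj_on (conjugate G g) (carrier G)"
  by (rule inj_on_inverseI[where g = "conjugate G (inv g)"]) simp

lemma conj_subgroup_eq:
  assumes "x \<in> carrier G" "P \<subseteq> carrier G"
  shows "conj_subgroup G P x = conjugate G (inv x) ` P"
  using assms by (auto simp: conj_subgroup_def conjugate_def r_coset_def l_coset_def)

lemma normal_conjugate: "N \<lhd> G \<Longrightarrow> g \<in> carrier G \<Longrightarrow> x \<in> N \<Longrightarrow> conjugate G g x \<in> N"
  by (simp add: conjugate_def normal.inv_op_closed2)

lemma normalI_conjugate:
  "subgroup N G \<Longrightarrow> (\<And>g x. g \<in> carrier G \<Longrightarrow> x \<in> N \<Longrightarrow> conjugate G g x \<in> N) \<Longrightarrow> N \<lhd> G"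
  by (simp add: normal_inv_iff conjugate_def)

lemma subgroup_normalizes_self: "subgroup H G \<Longrightarrow> normalizes G H H"
  by (simp add: normalizes_def conjugate_def subgroup.m_closed subgroup.m_inv_closed)

lemma normalizes_mono: "normalizes G L X \<Longrightarrow> M \<subseteq> L \<Longrightarrow> normalizes G M X"
  by (auto simp: normalizes_def)

lemma normalizes_Int: "normalizes G L X \<Longrightarrow> normalizes G L Y \<Longrightarrow> normalizes G L (X \<inter> Y)"
  by (auto simp: normalizes_def)

lemma set_multI: "x \<in> X \<Longrightarrow> y \<in> Y \<Longrightarrow> x \<otimes> y \<in> X <#> Y"
  by (auto simp: set_mult_def)

lemma set_multE:
  assumes "z \<in> X <#> Y" obtains x y where "x \<in> X" "y \<in> Y" "z = x \<otimes> y"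
  using assms by (auto simp: set_mult_def)

lemma subset_set_mult_left:
  assumes "X \<subseteq> carrier G" "subgroup Y G"
  shows "X \<subseteq> X <#> Y"
proof
  fix x assume "x \<in> X"
  then have "x \<otimes> \<one> \<in> X <#> Y" using assms by (intro set_multI subgroup.one_closed)
  then show "x \<in> X <#> Y" using \<open>x \<in> X\<close> assms by auto
qed

lemma subset_set_mult_right:
  assumes "subgroup X G" "Y \<subseteq> carrier G"
  shows "Y \<subseteq> X <#> Y"
proof
  fix y assume "y \<in> Y"
  then have "\<one> \<otimes> y \<in> X <#> Y" using assms by (intro set_multI subgroup.one_closed)
  then show "y \<in> X <#> Y" using \<open>y \<in> Y\<close> assms by auto
qed

lemma set_mult_subset_subgroup: "subgroup Z G \<Longrightarrow> X \<subseteq> Z \<Longrightarrow> Y \<subseteq> Z \<Longrightarrow> X <#> Y \<subseteq> Z"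
  by (auto elim!: set_multE intro: subgroup.m_closed)

text \<open>Taking inverses exchanges \<open>XY\<close> and \<open>YX\<close>, so one inclusion implies the other.\<close>

lemma permuteI:
  assumes "subgroup X G" "subgroup Y G" "X <#> Y \<subseteq> Y <#> X"
  shows "X <#> Y = Y <#> X"
proof
  note c = subgroup.mem_carrier[OF assms(1)] subgroup.mem_carrier[OF assms(2)]
  show "Y <#> X \<subseteq> X <#> Y"
  proof
    fix z assume "z \<in> Y <#> X"
    then obtain y x where z: "y \<in> Y" "x \<in> X" "z = y \<otimes> x" by (rule set_multE)
    have "inv x \<otimes> inv y \<in> Y <#> X"
      using assms z by (intro subsetD[OF assms(3)] set_multI) (auto intro: subgroup.m_inv_closed)
    then obtain y' x' where z': "y' \<in> Y" "x' \<in> X" "inv x \<otimes> inv y = y' \<otimes> x'" by (rule set_multE)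
    have "z = inv (inv x \<otimes> inv y)" using z c by (simp add: inv_mult_group)
    also have "\<dots> = inv x' \<otimes> inv y'" using z' c by (simp add: inv_mult_group)
    also have "\<dots> \<in> X <#> Y" using assms z' by (intro set_multI) (auto intro: subgroup.m_inv_closed)
    finally show "z \<in> X <#> Y" .
  qed
qed (rule assms(3))

lemma permute_subgroup:
  assumes "subgroup X G" "subgroup Y G" "X <#> Y = Y <#> X"
  shows "subgroup (X <#> Y) G"
proof (rule subgroupI)
  note c = subgroup.mem_carrier[OF assms(1)] subgroup.mem_carrier[OF assms(2)]
  show "X <#> Y \<subseteq> carrier G" using c by (auto elim!: set_multE)
  show "X <#> Y \<noteq> {}" 
    using set_multI[OF subgroup.one_closed[OF assms(1)] subgroup.one_closed[OF assms(2)]] by auto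
  show "inv a \<in> X <#> Y" if a: "a \<in> X <#> Y" for a
  proof -
    obtain x y where "x \<in> X" "y \<in> Y" "a = x \<otimes> y" using a by (rule set_multE)
    then have "inv a = inv y \<otimes> inv x" "inv y \<in> Y" "inv x \<in> X"
      using c assms by (auto simp: inv_mult_group subgroup.m_inv_closed)
    then show ?thesis by (simp add: assms(3) set_multI)
  qed
  show "a \<otimes> b \<in> X <#> Y" if ab: "a \<in> X <#> Y" "b \<in> X <#> Y" for a b
  proof -
    obtain x y where a: "x \<in> X" "y \<in> Y" "a = x \<otimes> y" using ab(1) by (rule set_multE)
    obtain x' y' where b: "x' \<in> X" "y' \<in> Y" "b = x' \<otimes> y'" using ab(2) by (rule set_multE)
    have "y \<otimes> x' \<in> X <#> Y" using a b by (simp add: assms(3) set_multI)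
    then obtain u v where u: "u \<in> X" "v \<in> Y" "y \<otimes> x' = u \<otimes> v" by (rule set_multE)
    have "a \<otimes> b = x \<otimes> (y \<otimes> x') \<otimes> y'" using a b c by (simp add: m_assoc)
    also have "\<dots> = (x \<otimes> u) \<otimes> (v \<otimes> y')" using a b c u by (simp add: m_assoc)
    finally show ?thesis using a b u assms(1,2) by (simp add: set_multI subgroup.m_closed)
  qed
qed

lemma normalizes_permute:
  assumes "subgroup X G" "subgroup Y G" "normalizes G X Y"
  shows "X <#> Y = Y <#> X"
proof (rule permuteI[OF assms(1,2)], rule)
  fix z assume "z \<in> X <#> Y"
  then obtain x y where z: "x \<in> X" "y \<in> Y" "z = x \<otimes> y" by (rule set_multE)
  then have "z = conjugate G x y \<otimes> x" using assms(1,2)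
    by (simp add: conjugate_def m_assoc subgroup.mem_carrier)
  then show "z \<in> Y <#> X" using z assms(3) by (auto simp: normalizes_def intro: set_multI)
qed

lemma normalizes_product_subgroup:
  assumes "subgroup X G" "subgroup Y G" "normalizes G X Y"
  shows "subgroup (X <#> Y) G"
  using assms normalizes_permute permute_subgroup by blast

lemma normalizes_set_mult:
  assumes "L \<subseteq> carrier G" "X \<subseteq> carrier G" "Y \<subseteq> carrier G" "normalizes G L X" "normalizes G L Y"
  shows "normalizes G L (X <#> Y)"
  unfolding normalizes_def
proof (intro ballI)
  fix l z assume l: "l \<in> L" and "z \<in> X <#> Y"
  then obtain x y where z: "x \<in> X" "y \<in> Y" "z = x \<otimes> y" by (auto elim: set_multE)
  then have "conjugate G l z = conjugate G l x \<otimes> conjugate G l y"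
    using l assms by (auto intro!: conjugate_mult)
  then show "conjugate G l z \<in> X <#> Y"
    using z l assms(4,5) by (auto simp: normalizes_def intro: set_multI)
qed

text \<open>In the finite case \<open>conjugate s\<close> maps \<open>K\<close> onto \<open>K\<close>, so the inverses of the elements of \<open>S\<close>
  normalize \<open>K\<close> as well.\<close>

lemma normalizes_generate:
  assumes fin: "finite (carrier G)" and K: "subgroup K G" and S: "S \<subseteq> carrier G" and "normalizes G S K"
  shows "normalizes G (generate G S) K"
proof -
  have S_eq: "conjugate G s ` K = K" if "s \<in> S" for s
  proof (rule card_subset_eq)
    show "finite K" using fin K by (meson finite_subset subgroup.subset)
    show "conjugate G s ` K \<subseteq> K" using assms that by (auto simp: normalizes_def)
    show "card (conjugate G s ` K) = card K"
      using that S K by (meson card_image inj_conjugate inj_on_subset subgroup.subset subsetD)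
  qed
  have "conjugate G l ` K = K" if "l \<in> generate G S" for l
    using that
  proof (induction rule: generate.induct)
    case one
    then show ?case using K by (auto simp: subgroup.mem_carrier image_iff)
  next
    case (incl h)
    then show ?case by (rule S_eq)
  next
    case (inv h)
    then have h: "h \<in> carrier G" using S by auto
    have "conjugate G (inv h) ` K = conjugate G (inv h) ` conjugate G h ` K"
      using S_eq inv by simp
    also have "\<dots> = K" using h K by (force simp: image_image subgroup.mem_carrier)
    finally show ?case .
  next
    case (eng h1 h2)
    then have c: "h1 \<in> carrier G" "h2 \<in> carrier G" using generate_in_carrier[OF S] by auto
    have "conjugate G (h1 \<otimes> h2) ` K = conjugate G h1 ` conjugate G h2 ` K"
      unfolding image_image
      by (rule image_cong) (use c K in \<open>auto simp: conjugate_conjugate subgroup.mem_carrier\<close>)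
    then show ?case using eng by simp
  qed
  then show ?thesis by (auto simp: normalizes_def)
qed

lemma generate_permute:
  assumes A: "subgroup A G" and B: "subgroup B G" and Q: "subgroup Q G"
    and "A <#> Q = Q <#> A" "B <#> Q = Q <#> B"
  shows "generate G (A \<union> B) <#> Q = Q <#> generate G (A \<union> B)"
proof -
  have AB: "A \<union> B \<subseteq> carrier G" using A B by (simp add: subgroup.subset)
  note J = generate_is_subgroup[OF AB]
  have incl: "A <#> Q \<subseteq> Q <#> generate G (A \<union> B)" "B <#> Q \<subseteq> Q <#> generate G (A \<union> B)"
    unfolding assms(4,5) by (intro mono_set_mult; use generate.incl[of _ "A \<union> B" G] in auto)+
  have "\<forall>q\<in>Q. x \<otimes> q \<in> Q <#> generate G (A \<union> B)" if "x \<in> generate G (A \<union> B)" for x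
    using that
  proof (induction rule: generate.induct)
    case one
    have "q \<otimes> \<one> \<in> Q <#> generate G (A \<union> B)" if "q \<in> Q" for q
      by (intro set_multI that generate.one)
    then show ?case using Q by (simp add: subgroup.mem_carrier)
  next
    case (incl h)
    then show ?case using \<open>A <#> Q \<subseteq> _\<close> \<open>B <#> Q \<subseteq> _\<close> by (auto intro: set_multI)
  next
    case (inv h)
    then have "inv h \<in> A \<or> inv h \<in> B" using A B by (auto intro: subgroup.m_inv_closed)
    then show ?case using \<open>A <#> Q \<subseteq> _\<close> \<open>B <#> Q \<subseteq> _\<close> by (auto intro: set_multI)
  next
    case (eng h1 h2)
    note c = eng(1,2)[THEN generate_in_carrier[OF AB]] subgroup.mem_carrier[OF Q]
      generate_in_carrier[OF AB]
    show ?case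
    proof
      fix q assume q: "q \<in> Q"
      then obtain q' j where 1: "q' \<in> Q" "j \<in> generate G (A \<union> B)" "h2 \<otimes> q = q' \<otimes> j"
        using eng.IH(2) by (meson set_multE)
      then obtain q'' j' where 2: "q'' \<in> Q" "j' \<in> generate G (A \<union> B)" "h1 \<otimes> q' = q'' \<otimes> j'"
        using eng.IH(1) by (meson set_multE)
      have "h1 \<otimes> h2 \<otimes> q = h1 \<otimes> q' \<otimes> j" using 1 q c by (simp add: m_assoc)
      also have "\<dots> = q'' \<otimes> (j' \<otimes> j)" using 1 2 c by (simp add: m_assoc)
      finally show "h1 \<otimes> h2 \<otimes> q \<in> Q <#> generate G (A \<union> B)"
        using 1 2 by (auto intro: set_multI generate.eng)
    qed
  qed
  then show ?thesis by (intro permuteI J Q) (auto elim: set_multE)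
qed

end

section \<open>Relative order conditions\<close>

text \<open>For \<open>Y\<close> normal in a finite group \<open>X\<close>, \<open>pi_modulo\<close> says that \<open>X/Y\<close> is a \<open>\<pi>\<close>-group. The version with
  exponents makes sense without normality or inclusion, and passes to intersections directly.\<close>

definition pi_modulo :: "('a, 'b) monoid_scheme \<Rightarrow> nat set \<Rightarrow> 'a set \<Rightarrow> 'a set \<Rightarrow> bool" where
  "pi_modulo G \<pi> X Y \<longleftrightarrow> (\<forall>x\<in>X. \<exists>m. pi_number \<pi> m \<and> x [^]\<^bsub>G\<^esub> (m::nat) \<in> Y)"

definition pi_index :: "nat set \<Rightarrow> 'a set \<Rightarrow> 'a set \<Rightarrow> bool" where
  "pi_index \<pi> X Y \<longleftrightarrow> (\<exists>m. pi_number \<pi> m \<and> card X = card Y * m)"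

definition primary_elements :: "('a, 'b) monoid_scheme \<Rightarrow> nat set \<Rightarrow> 'a set" where
  "primary_elements G \<pi> =
    {x \<in> carrier G. \<exists>q n. prime q \<and> q \<in> \<pi> \<and> x [^]\<^bsub>G\<^esub> (q ^ n :: nat) = \<one>\<^bsub>G\<^esub>}"

text \<open>For finite \<open>G\<close> this is the least normal subgroup of \<open>G\<close> whose index has no prime divisor in \<open>\<pi>\<close>,
  that is \<open>O\<^sup>\<pi>\<^sup>'(G)\<close>.\<close>

abbreviation primary_subgroup :: "('a, 'b) monoid_scheme \<Rightarrow> nat set \<Rightarrow> 'a set" where
  "primary_subgroup G \<pi> \<equiv> generate G (primary_elements G \<pi>)"

lemma pi_index_refl: "pi_index \<pi> K K"
  unfolding pi_index_def by (rule exI[of _ 1]) simp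

lemma pi_index_trans: "pi_index \<pi> K D \<Longrightarrow> pi_index \<pi> D H \<Longrightarrow> pi_index \<pi> K H"
  unfolding pi_index_def by (metis mult.assoc pi_number_mult)

context group
begin

lemma subgroup_nat_pow_closed: "subgroup H G \<Longrightarrow> x \<in> H \<Longrightarrow> x [^] (n::nat) \<in> H"
  by (induction n) (auto intro: subgroup.m_closed subgroup.one_closed)

lemma pow_gcd_mem:
  assumes "subgroup H G" "x \<in> carrier G" "x [^] (m::nat) \<in> H" "x [^] (n::nat) \<in> H"
  shows "x [^] gcd m n \<in> H"
proof -
  obtain a b where ab: "a * int m + b * int n = int (gcd m n)"
    using bezout_int[of "int m" "int n"] by auto
  have "x [^] int (gcd m n) = (x [^] int m) [^] a \<otimes> (x [^] int n) [^] b"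
    using assms(2) by (simp add: int_pow_pow int_pow_mult mult.commute flip: ab)
  also have "\<dots> \<in> H"
    unfolding int_pow_int
    by (intro subgroup.m_closed[OF assms(1)] subgroup_int_pow_closed[OF assms(1) assms(3)]
        subgroup_int_pow_closed[OF assms(1) assms(4)])
  finally show ?thesis by (simp only: int_pow_int)
qed

lemma coprime_pow_mem:
  assumes "subgroup H G" "x \<in> carrier G" "x [^] (m::nat) \<in> H" "x [^] (n::nat) \<in> H" "coprime m n"
  shows "x \<in> H"
proof -
  have "gcd m n = 1" using assms(5) by simp
  from pow_gcd_mem[OF assms(1-4), unfolded this] show ?thesis using assms(2) by simp
qed

text \<open>Let \<open>d\<close> be the least positive exponent with \<open>x\<^sup>d \<in> H\<close>. If a prime \<open>q \<notin> \<pi>\<close> divided \<open>d\<close>, then, with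
  \<open>n'\<close> the part of the group order prime to \<open>q\<close>, the power \<open>x\<^sup>n\<^sup>'\<close> would have \<open>q\<close>-power order and
  hence lie in \<open>H\<close>, and \<open>gcd d n'\<close> would be a smaller such exponent.\<close>

lemma exists_pi_pow_mem:
  assumes fin: "finite (carrier G)" and H: "subgroup H G" and x: "x \<in> carrier G"
    and prim: "\<And>k. x [^] (k::nat) \<in> primary_elements G (- \<pi>) \<Longrightarrow> x [^] k \<in> H"
  shows "\<exists>m. pi_number \<pi> m \<and> x [^] m \<in> H"
proof -
  define S where "S = (\<lambda>k::nat. k > 0 \<and> x [^] k \<in> H)"
  have o: "order G > 0" using fin by (simp add: order_gt_0_iff_finite)
  then have "S (order G)" using x H by (simp add: S_def pow_order_eq_1 subgroup.one_closed)
  then obtain d where d: "S d" "\<And>k. S k \<Longrightarrow> d \<le> k"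
    by (metis LeastI Least_le)
  have "q \<in> \<pi>" if q: "prime q" "q dvd d" for q
  proof (rule ccontr)
    assume "q \<notin> \<pi>"
    obtain n' e where n': "order G = q ^ e * n'" "\<not> q dvd n'"
      using o q(1) by (metis multiplicity_decompose' not_prime_unit not_gr0)
    have "x [^] n' \<in> carrier G" "(x [^] n') [^] (q ^ e) = \<one>"
      using x n'(1) pow_order_eq_1[OF x] by (simp_all add: nat_pow_pow mult.commute)
    then have "x [^] n' \<in> H"
      using q(1) \<open>q \<notin> \<pi>\<close> by (intro prim) (auto simp: primary_elements_def)
    then have "S (gcd d n')" using pow_gcd_mem[OF H x] d(1) by (auto simp: S_def)
    then have "d dvd n'" using d by (metis S_def dvd_imp_le gcd_dvd1 gcd_dvd2 le_antisym)
    then show False using q(2) n'(2) by (meson dvd_trans)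
  qed
  then show ?thesis using d(1) by (auto simp: S_def pi_number_def)
qed

lemma pi_modulo_trans:
  assumes "X \<subseteq> carrier G" "pi_modulo G \<pi> X Y" "pi_modulo G \<pi> Y Z"
  shows "pi_modulo G \<pi> X Z"
  unfolding pi_modulo_def
proof
  fix x assume "x \<in> X"
  then obtain m where m: "pi_number \<pi> m" "x [^] m \<in> Y" using assms(2) by (auto simp: pi_modulo_def)
  then obtain n where n: "pi_number \<pi> n" "(x [^] m) [^] n \<in> Z" using assms(3) by (auto simp: pi_modulo_def)
  then show "\<exists>m. pi_number \<pi> m \<and> x [^] m \<in> Z"
    using m n \<open>x \<in> X\<close> assms(1)
    by (intro exI[of _ "m * n"]) (simp add: nat_pow_pow pi_number_mult subset_iff)
qed

lemma pi_modulo_Int: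
  assumes "X \<subseteq> carrier G" "subgroup R G" "subgroup S G" "pi_modulo G \<pi> X R" "pi_modulo G \<pi> Y S"
  shows "pi_modulo G \<pi> (X \<inter> Y) (R \<inter> S)"
  unfolding pi_modulo_def
proof
  fix x assume x: "x \<in> X \<inter> Y"
  then obtain m where m: "pi_number \<pi> m" "x [^] m \<in> R" using assms(4) by (auto simp: pi_modulo_def)
  obtain n where n: "pi_number \<pi> n" "x [^] n \<in> S" using assms(5) x by (auto simp: pi_modulo_def)
  have "x [^] (m * n) \<in> R" "x [^] (m * n) \<in> S"
    using m n x assms(1) subgroup_nat_pow_closed[OF assms(2), of "x [^] m" n]
      subgroup_nat_pow_closed[OF assms(3), of "x [^] n" m]
    by (simp_all add: nat_pow_pow mult.commute[of n m] subset_iff)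
  then show "\<exists>m. pi_number \<pi> m \<and> x [^] m \<in> R \<inter> S" using m n by (blast intro: pi_number_mult)
qed

lemma pow_mult_coset:
  assumes X: "subgroup X G" and Y: "subgroup Y G" and n: "normalizes G X Y" and "x \<in> X" "y \<in> Y"
  shows "\<exists>z\<in>Y. (x \<otimes> y) [^] (k::nat) = x [^] k \<otimes> z"
proof (induction k)
  case 0
  then show ?case using Y by (auto intro!: bexI[of _ \<one>] subgroup.one_closed)
next
  case (Suc k)
  note c = subgroup.mem_carrier[OF X] subgroup.mem_carrier[OF Y]
  obtain z where z: "z \<in> Y" "(x \<otimes> y) [^] k = x [^] k \<otimes> z" using Suc by blast
  have x': "x \<in> carrier G" "inv x \<in> X" using assms c by (auto intro: subgroup.m_inv_closed)
  have "(x \<otimes> y) [^] Suc k = x [^] k \<otimes> x \<otimes> (conjugate G (inv x) z \<otimes> y)"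
    using x' z assms(5) c by (simp add: conjugate_def m_assoc)
  moreover have "conjugate G (inv x) z \<otimes> y \<in> Y"
    using n z x' assms by (intro subgroup.m_closed[OF Y]) (auto simp: normalizes_def)
  ultimately show ?case by auto
qed

lemma pi_modulo_set_mult:
  assumes X: "subgroup X G" and Y: "subgroup Y G" and n: "normalizes G X Y"
    and "pi_modulo G \<pi> X Z"
  shows "pi_modulo G \<pi> (X <#> Y) (Z <#> Y)"
  unfolding pi_modulo_def
proof
  fix w assume "w \<in> X <#> Y"
  then obtain x y where w: "x \<in> X" "y \<in> Y" "w = x \<otimes> y" by (rule set_multE)
  obtain m where m: "pi_number \<pi> m" "x [^] m \<in> Z" using assms w by (auto simp: pi_modulo_def)
  obtain z where "z \<in> Y" "w [^] m = x [^] m \<otimes> z" using pow_mult_coset[OF X Y n] w by blast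
  then have "w [^] m \<in> Z <#> Y" using m by (simp add: set_multI)
  then show "\<exists>m. pi_number \<pi> m \<and> w [^] m \<in> Z <#> Y" using m by blast
qed

lemma pi_modulo_trivial_set_mult:
  assumes "subgroup X G" "subgroup Y G" "normalizes G X Y" "pi_modulo G \<pi> X {\<one>}"
  shows "pi_modulo G \<pi> (X <#> Y) Y"
proof -
  have "{\<one>} <#> Y = Y" using assms(2) by (auto simp: set_mult_def subgroup.mem_carrier)
  then show ?thesis using pi_modulo_set_mult[OF assms] by simp
qed

lemma lagrange_subgroups:
  assumes "subgroup H G" "subgroup K G" "H \<subseteq> K"
  shows "card K = card H * card ((#>) H ` K)"
proof -
  interpret K: group "G\<lparr>carrier := K\<rparr>" using assms by (rule_tac subgroup_imp_group)
  have "rcosets\<^bsub>G\<lparr>carrier := K\<rparr>\<^esub> H = (#>) H ` K" by (auto simp: RCOSETS_def)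
  then show ?thesis
    using K.lagrange[OF subgroup_incl[OF assms]] by (simp add: order_def mult.commute)
qed

lemma finite_subgroup: "finite (carrier G) \<Longrightarrow> subgroup H G \<Longrightarrow> finite H"
  by (meson finite_subset subgroup.subset)

lemma card_subgroup_pos: "finite (carrier G) \<Longrightarrow> subgroup H G \<Longrightarrow> card H > 0"
  using finite_subgroup subgroup.one_closed[of H G] by (auto simp: card_gt_0_iff)

lemma pi_index_tower:
  assumes fin: "finite (carrier G)" and "subgroup H G" "subgroup D G" "subgroup K G" "H \<subseteq> D" "D \<subseteq> K"
    and "pi_index \<pi> K H"
  shows "pi_index \<pi> D H"
proof -
  obtain m where m: "pi_number \<pi> m" "card K = card H * m" using assms by (auto simp: pi_index_def)
  obtain a b where "card K = card D * a" and b: "card D = card H * b"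
    using lagrange_subgroups[OF assms(3,4,6)] lagrange_subgroups[OF assms(2,3,5)] by blast
  then have "card H * m = card H * (b * a)" using m(2) by (simp add: mult.assoc)
  then have "m = b * a" using card_subgroup_pos[OF fin assms(2)] by simp
  then have "pi_number \<pi> b" using m(1) by (auto intro: pi_number_dvd)
  then show ?thesis using b unfolding pi_index_def by blast
qed

lemma pi_index_disjoint_eq:
  assumes fin: "finite (carrier G)" and "subgroup H G" "subgroup D G" "H \<subseteq> D"
    and "pi_index \<pi> D H" "pi_index \<tau> D H" "\<pi> \<inter> \<tau> = {}"
  shows "D = H"
proof -
  obtain m n where m: "pi_number \<pi> m" "card D = card H * m" "pi_number \<tau> n" "card D = card H * n"
    using assms(5,6) unfolding pi_index_def by blast
  then have "m = n" using card_subgroup_pos[OF fin assms(2)] by auto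
  then have "m = 1" using pi_number_coprime[OF m(1,3) assms(7)] by simp
  then have "card D = card H" using m by simp
  then show ?thesis using card_subset_eq[OF finite_subgroup[OF fin assms(3)] assms(4)] by simp
qed

lemma card_image_eq_if_same_fibres:
  assumes "\<And>x y. x \<in> Q \<Longrightarrow> y \<in> Q \<Longrightarrow> f x = f y \<longleftrightarrow> g x = g y"
  shows "card (f ` Q) = card (g ` Q)"
proof -
  have "inj_on (\<lambda>c. {y \<in> Q. f y = c}) (f ` Q)" "inj_on (\<lambda>c. {y \<in> Q. g y = c}) (g ` Q)"
    by (auto simp: inj_on_def)
  note card_image[OF this(1)] card_image[OF this(2)]
  moreover have "(\<lambda>c. {y \<in> Q. f y = c}) ` f ` Q = (\<lambda>c. {y \<in> Q. g y = c}) ` g ` Q"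
    unfolding image_image using assms by (intro image_cong) auto
  ultimately show ?thesis by simp
qed

text \<open>The index of \<open>K\<close> in \<open>KQ\<close> equals the index of \<open>K \<inter> Q\<close> in \<open>Q\<close>: for \<open>x, y \<in> Q\<close>, the cosets
  \<open>Kx\<close> and \<open>Ky\<close> coincide exactly if \<open>(K \<inter> Q)x\<close> and \<open>(K \<inter> Q)y\<close> do.\<close>

lemma pi_index_set_mult:
  assumes fin: "finite (carrier G)" and K: "subgroup K G" and Q: "subgroup Q G"
    and KQ: "K <#> Q = Q <#> K" and "pi_number \<pi> (card Q)"
  shows "pi_index \<pi> (K <#> Q) K"
proof -
  note c = subgroup.mem_carrier[OF K] subgroup.mem_carrier[OF Q]
  define D where "D = K \<inter> Q"
  have D: "subgroup D G" unfolding D_def by (rule subgroups_Inter_pair[OF K Q])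
  have coset_iff: "H #> x = H #> y \<longleftrightarrow> x \<otimes> inv y \<in> H"
    if "subgroup H G" "x \<in> carrier G" "y \<in> carrier G" for H x y
  proof
    assume "H #> x = H #> y"
    then have "x \<in> H #> y" using rcos_self[of x H] that by simp
    then show "x \<otimes> inv y \<in> H" using that
      by (auto simp: r_coset_def m_assoc subgroup.mem_carrier)
  next
    assume "x \<otimes> inv y \<in> H"
    then have "x \<otimes> inv y \<otimes> y \<in> H #> y" by (auto simp: r_coset_def)
    then have "x \<in> H #> y" using that by (simp add: m_assoc)
    then show "H #> x = H #> y" using that repr_independence by simp
  qed
  have "(#>) K ` (K <#> Q) = (#>) K ` Q"
  proof
    show "(#>) K ` (K <#> Q) \<subseteq> (#>) K ` Q"
    proof
      fix C assume "C \<in> (#>) K ` (K <#> Q)"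
      then obtain k q where "k \<in> K" "q \<in> Q" "C = K #> (k \<otimes> q)" by (auto elim: set_multE)
      moreover from this have "C = (K #> k) #> q"
        using c K by (simp add: coset_mult_assoc subgroup.subset)
      ultimately show "C \<in> (#>) K ` Q"
        using coset_join2[of k K] c K by auto
    qed
  qed (use subset_set_mult_right[OF K subgroup.subset[OF Q]] in auto)
  moreover have "card ((#>) K ` Q) = card ((#>) D ` Q)"
  proof -
    have "K #> x = K #> y \<longleftrightarrow> D #> x = D #> y" if "x \<in> Q" "y \<in> Q" for x y
    proof -
      have "x \<otimes> inv y \<in> Q" using that Q by (simp add: subgroup.m_closed subgroup.m_inv_closed)
      moreover have "x \<in> carrier G" "y \<in> carrier G" using that Q by (simp_all add: subgroup.mem_carrier)
      ultimately show ?thesis using coset_iff[OF K, of x y] coset_iff[OF D, of x y] by (simp add: D_def)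
    qed
    then show ?thesis by (intro card_image_eq_if_same_fibres)
  qed
  ultimately have "card (K <#> Q) = card K * card ((#>) D ` Q)"
    using lagrange_subgroups[OF K permute_subgroup[OF K Q KQ]]
      subset_set_mult_left[OF subgroup.subset[OF K] Q] by simp
  moreover have "pi_number \<pi> (card ((#>) D ` Q))"
    using lagrange_subgroups[OF D Q] assms(5) by (auto simp: D_def intro: pi_number_dvd)
  ultimately show ?thesis by (auto simp: pi_index_def)
qed

end

section \<open>Projectors\<close>

text \<open>The projector property expressed inside \<open>G\<close>, so that no quotient groups (and no change of
  element type) occur in inductive arguments: \<open>W\<close> is the preimage of a \<open>\<pi>\<close>-subgroup of \<open>G/N\<close>.\<close>

definition modular_projector :: "('a, 'b) monoid_scheme \<Rightarrow> nat set \<Rightarrow> 'a set \<Rightarrow> bool" where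
  "modular_projector G \<pi> P \<longleftrightarrow> subgroup P G \<and> pi_number \<pi> (card P) \<and>
    (\<forall>N W. N \<lhd> G \<and> subgroup W G \<and> P \<subseteq> W \<and> N \<subseteq> W \<and> pi_modulo G \<pi> W N \<longrightarrow> W \<subseteq> P <#>\<^bsub>G\<^esub> N)"

context group
begin

lemma modular_projectorD:
  assumes "modular_projector G \<pi> P" "N \<lhd> G" "subgroup W G" "P \<subseteq> W" "N \<subseteq> W" "pi_modulo G \<pi> W N"
  shows "W \<subseteq> P <#> N"
  using assms unfolding modular_projector_def by blast

lemma pow_card_eq_one:
  assumes "subgroup P G" "x \<in> P"
  shows "x [^] card P = \<one>"
proof -
  interpret P: group "G\<lparr>carrier := P\<rparr>" using assms(1) by (rule subgroup_imp_group)
  show ?thesis using P.pow_order_eq_1[of x] assms(2) by (simp add: order_def nat_pow_consistent[symmetric])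
qed

lemma pi_modulo_one:
  assumes "subgroup P G" "pi_number \<pi> (card P)"
  shows "pi_modulo G \<pi> P {\<one>}"
  using assms pow_card_eq_one unfolding pi_modulo_def by blast

lemma carrier_product_Mod:
  assumes P: "subgroup P G" and N: "N \<lhd> G"
  shows "carrier (G\<lparr>carrier := P <#> N\<rparr> Mod N) = (#>) N ` P"
proof -
  interpret N: normal N G by fact
  have sub: "subgroup N G" by (rule normal_imp_subgroup[OF N])
  note c = subgroup.mem_carrier[OF P] subgroup.mem_carrier[OF sub]
  have "N #> (x \<otimes> n) = N #> x" if "x \<in> P" "n \<in> N" for x n
  proof -
    have "x \<otimes> n = conjugate G x n \<otimes> x" using that c by (simp add: conjugate_def m_assoc)
    moreover have "conjugate G x n \<in> N" using that c N by (simp add: normal_conjugate)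
    ultimately show ?thesis using that c sub
      by (metis coset_join2 coset_mult_assoc subgroup.subset)
  qed
  then have "(#>) N ` (P <#> N) = (#>) N ` P"
    using subset_set_mult_left[OF subgroup.subset[OF P] sub]
    by (force elim: set_multE)
  then show ?thesis by (simp add: carrier_FactGroup)
qed

text \<open>A prime \<open>p \<notin> \<pi>\<close> dividing the order of \<open>W/N\<close> would give, by Cauchy's theorem, a coset \<open>Nw \<noteq> N\<close>
  with \<open>w\<^sup>p \<in> N\<close>; as some power of \<open>w\<close> with exponent prime to \<open>p\<close> also lies in \<open>N\<close>, so does \<open>w\<close>.\<close>

lemma pi_subgroup_cosets:
  assumes fin: "finite (carrier G)" and N: "N \<lhd> G" and W: "subgroup W G" and NW: "N \<subseteq> W"
    and mod: "pi_modulo G \<pi> W N"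
  shows "pi_subgroup \<pi> (G Mod N) ((#>) N ` W)"
proof -
  interpret N: normal N G by fact
  interpret Q: group "G Mod N" by (rule N.factorgroup_is_group)
  let ?K = "(#>) N ` W"
  have h: "group_hom G (G Mod N) ((#>) N)"
    by unfold_locales (rule N.r_coset_hom_Mod)
  have K: "subgroup ?K (G Mod N)" by (rule group_hom.subgroup_img_is_subgroup[OF h W])
  interpret K: group "(G Mod N)\<lparr>carrier := ?K\<rparr>" using K by (rule Q.subgroup_imp_group)
  have finK: "finite ?K" using fin W by (simp add: finite_subgroup)
  have "p \<in> \<pi>" if p: "prime p" "p dvd order ((G Mod N)\<lparr>carrier := ?K\<rparr>)" for p
  proof (rule ccontr)
    assume "p \<notin> \<pi>"
    from p(2) obtain m where "order ((G Mod N)\<lparr>carrier := ?K\<rparr>) = p ^ 1 * m" by auto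
    from sylow_thm[OF p(1) K.is_group this] finK
    obtain H where H: "subgroup H ((G Mod N)\<lparr>carrier := ?K\<rparr>)" "card H = p ^ 1" by auto
    have "card H > 1" using H(2) prime_gt_1_nat[OF p(1)] by simp
    then have "\<not> H \<subseteq> {N}" using card_mono[of "{N}" H] by auto
    then obtain c where c: "c \<in> H" "c \<noteq> N" by blast
    then have "c \<in> ?K" using subgroup.subset[OF H(1)] by auto
    then obtain w where w: "w \<in> W" "c = N #> w" by auto
    then have wc: "w \<in> carrier G" using W by (simp add: subgroup.mem_carrier)
    have "c [^]\<^bsub>(G Mod N)\<lparr>carrier := ?K\<rparr>\<^esub> card H = \<one>\<^bsub>(G Mod N)\<lparr>carrier := ?K\<rparr>\<^esub>"
      using K.pow_card_eq_one[OF H(1) c(1)] by simp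
    then have "c [^]\<^bsub>G Mod N\<^esub> p = N"
      using H(2) by (simp add: Q.nat_pow_consistent[symmetric])
    then have "N #> (w [^] p) = N" using w wc by (simp add: N.FactGroup_pow)
    then have "w [^] p \<in> N"
      using wc N.subgroup_axioms by (auto intro: coset_join1 simp: subgroup.subset)
    moreover obtain m where m: "pi_number \<pi> m" "w [^] m \<in> N" using mod w by (auto simp: pi_modulo_def)
    moreover have "coprime p m"
      using m(1) p(1) \<open>p \<notin> \<pi>\<close> by (auto simp: pi_number_def intro: prime_imp_coprime)
    ultimately have "w \<in> N" using coprime_pow_mem[OF N.subgroup_axioms wc] by blast
    then show False using c w by (simp add: N.rcos_const)
  qed
  then show ?thesis using K finK by (auto simp: pi_subgroup_def pi_group_def K.is_group)
qed

lemma pi_projector_modular: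
  assumes fin: "finite (carrier G)" and P: "pi_projector \<pi> G P"
  shows "modular_projector G \<pi> P"
  unfolding modular_projector_def
proof (intro conjI allI impI)
  have subP: "subgroup P G"
    and max: "\<And>N. N \<lhd> G \<Longrightarrow> pi_maximal \<pi> (G Mod N) ((#>) N ` P)"
    using P carrier_product_Mod by (auto simp: pi_projector_def)
  show "subgroup P G" by fact
  have "pi_subgroup \<pi> (G Mod {\<one>}) ((#>) {\<one>} ` P)"
    using max[OF one_is_normal] by (simp add: pi_maximal_def)
  moreover have "card ((#>) {\<one>} ` P) = card P"
    using subP by (intro card_image) (auto simp: inj_on_def r_coset_def subgroup.mem_carrier)
  ultimately show "pi_number \<pi> (card P)"
    using card_subgroup_pos[OF fin subP]
    by (auto simp: pi_subgroup_def pi_group_def pi_number_def order_def)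
  fix N W assume *: "N \<lhd> G \<and> subgroup W G \<and> P \<subseteq> W \<and> N \<subseteq> W \<and> pi_modulo G \<pi> W N"
  then have N: "subgroup N G" by (simp add: normal_imp_subgroup)
  have "pi_subgroup \<pi> (G Mod N) ((#>) N ` W)" using pi_subgroup_cosets[OF fin] * by blast
  moreover have "(#>) N ` P \<subseteq> (#>) N ` W" using * by auto
  ultimately have eq: "(#>) N ` P = (#>) N ` W"
    using max * by (auto simp: pi_maximal_def psubset_eq)
  show "W \<subseteq> P <#> N"
  proof
    fix w assume w: "w \<in> W"
    then obtain p where p: "p \<in> P" "N #> w = N #> p" using eq by (metis image_iff)
    have wc: "w \<in> carrier G" using w * by (auto simp: subgroup.mem_carrier)
    then have "w \<in> N #> p" using rcos_self[OF wc N] p by simp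
    then have "w \<in> N <#> P" using p by (auto simp: r_coset_def intro: set_multI)
    moreover have "P <#> N = N <#> P"
      using * subP N by (intro normalizes_permute) (auto simp: normalizes_def normal_conjugate subgroup.mem_carrier)
    ultimately show "w \<in> P <#> N" by simp
  qed
qed

lemma modular_projector_conjugate:
  assumes P: "modular_projector G \<pi> P" and g: "g \<in> carrier G"
  shows "modular_projector G \<pi> (conjugate G g ` P)"
  unfolding modular_projector_def
proof (intro conjI allI impI)
  have subP: "subgroup P G" and card: "pi_number \<pi> (card P)" using P by (auto simp: modular_projector_def)
  note c = subgroup.mem_carrier[OF subP]
  show "subgroup (conjugate G g ` P) G" by (rule conjugate_subgroup[OF g subP])
  have "card (conjugate G g ` P) = card P"
    using inj_conjugate[OF g] subP by (meson card_image inj_on_subset subgroup.subset)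
  then show "pi_number \<pi> (card (conjugate G g ` P))" using card by simp
  fix N W
  assume *: "N \<lhd> G \<and> subgroup W G \<and> conjugate G g ` P \<subseteq> W \<and> N \<subseteq> W \<and> pi_modulo G \<pi> W N"
  let ?W = "conjugate G (inv g) ` W"
  have cW: "\<And>w. w \<in> W \<Longrightarrow> w \<in> carrier G" and cN: "\<And>n. n \<in> N \<Longrightarrow> n \<in> carrier G"
    using * by (auto simp: subgroup.mem_carrier)
  have "?W \<subseteq> P <#> N"
  proof (rule modular_projectorD[OF P])
    show "N \<lhd> G" using * by simp
    show "subgroup ?W G" using * g by (simp add: conjugate_subgroup)
    show "P \<subseteq> ?W"
    proof
      fix p assume "p \<in> P"
      then have "p = conjugate G (inv g) (conjugate G g p)" "conjugate G g p \<in> W" using * g c by auto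
      then show "p \<in> ?W" by blast
    qed
    show "N \<subseteq> ?W"
    proof
      fix n assume "n \<in> N"
      then have "n = conjugate G (inv g) (conjugate G g n)" "conjugate G g n \<in> W"
        using * g cN normal_conjugate by auto
      then show "n \<in> ?W" by blast
    qed
    show "pi_modulo G \<pi> ?W N"
      unfolding pi_modulo_def
    proof
      fix v assume "v \<in> ?W"
      then obtain w where w: "w \<in> W" "v = conjugate G (inv g) w" by auto
      then obtain m where "pi_number \<pi> m" "w [^] m \<in> N" using * by (auto simp: pi_modulo_def)
      then show "\<exists>m. pi_number \<pi> m \<and> v [^] m \<in> N"
        using * w cW g normal_conjugate[of N "inv g" "w [^] m"] by (auto simp: conjugate_pow)
    qed
  qed
  show "W \<subseteq> conjugate G g ` P <#> N"
  proof
    fix w assume w: "w \<in> W"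
    then have "conjugate G (inv g) w \<in> P <#> N" using \<open>?W \<subseteq> _\<close> by blast
    then obtain p n where p: "p \<in> P" "n \<in> N" "conjugate G (inv g) w = p \<otimes> n" by (rule set_multE)
    have "w = conjugate G g (conjugate G (inv g) w)" using g w cW by simp
    also have "\<dots> = conjugate G g p \<otimes> conjugate G g n" using p g c cN by (simp add: conjugate_mult)
    finally show "w \<in> conjugate G g ` P <#> N"
      using p * g normal_conjugate by (auto intro: set_multI)
  qed
qed


section \<open>Normal sections covered by a projector\<close>

text \<open>If \<open>P\<close> normalizes a \<open>\<pi>\<close>-group modulo \<open>N\<close>, the product of the two is again a \<open>\<pi>\<close>-group modulo \<open>N\<close>,
  so maximality of \<open>P\<close> applies to it.\<close>

lemma pi_modulo_projector:
  assumes P: "modular_projector G \<pi> P"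
    and U: "subgroup U G" and "normalizes G P U" and "pi_modulo G \<pi> U N" and N: "N \<lhd> G" "N \<subseteq> U"
  shows "U \<subseteq> P <#> N"
proof -
  have subP: "subgroup P G" and "pi_modulo G \<pi> P {\<one>}"
    using P by (auto simp: modular_projector_def pi_modulo_one)
  have W: "subgroup (P <#> U) G" by (rule normalizes_product_subgroup[OF subP U assms(3)])
  have "pi_modulo G \<pi> (P <#> U) U"
    by (rule pi_modulo_trivial_set_mult[OF subP U assms(3)]) fact
  then have "pi_modulo G \<pi> (P <#> U) N"
    by (rule pi_modulo_trans[OF subgroup.subset[OF W] _ assms(4)])
  moreover have "U \<subseteq> P <#> U" by (rule subset_set_mult_right[OF subP subgroup.subset[OF U]])
  moreover have "P \<subseteq> P <#> U" by (rule subset_set_mult_left[OF subgroup.subset[OF subP] U])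
  ultimately have "P <#> U \<subseteq> P <#> N"
    using N by (intro modular_projectorD[OF P N(1) W]) auto
  then show ?thesis using \<open>U \<subseteq> P <#> U\<close> by blast
qed

lemma normal_core:
  assumes T: "subgroup T G"
  defines "N \<equiv> {x \<in> carrier G. \<forall>g\<in>carrier G. conjugate G g x \<in> T}"
  shows "N \<lhd> G" "N \<subseteq> T"
proof -
  show "N \<subseteq> T"
  proof
    fix x assume "x \<in> N"
    then have "conjugate G \<one> x \<in> T" "x \<in> carrier G" using one_closed unfolding N_def by blast+
    then show "x \<in> T" by simp
  qed
  have "subgroup N G"
  proof (rule subgroupI)
    have "\<one> \<in> N" using T by (auto simp: N_def subgroup.one_closed)
    then show "N \<noteq> {}" by blast
  qed (use T in \<open>auto simp: N_def conjugate_inv conjugate_mult subgroup.m_inv_closed subgroup.m_closed\<close>)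
  then show "N \<lhd> G"
    by (rule normalI_conjugate) (auto simp: N_def conjugate_conjugate)
qed

text \<open>Among the \<open>L\<close>-invariant subgroups of \<open>L\<close> properly above the core \<open>N\<close> of \<open>T\<close> take a smallest one. If all
  its \<open>G\<close>-conjugates lay in \<open>T\<close>, it would lie in the core; a conjugate not contained in \<open>T\<close> is still
  minimal, and therefore meets \<open>T\<close> in \<open>N\<close>.\<close>

lemma exists_complement_over_core:
  assumes fin: "finite (carrier G)" and L: "L \<lhd> G" and T: "subgroup T G" "T \<subseteq> L" "normalizes G L T"
    and N: "N \<lhd> G" "N \<subseteq> T" "N \<noteq> T"
    and core: "\<And>x. x \<in> carrier G \<Longrightarrow> (\<And>g. g \<in> carrier G \<Longrightarrow> conjugate G g x \<in> T) \<Longrightarrow> x \<in> N"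
  obtains C where "subgroup C G" "C \<subseteq> L" "normalizes G L C" "C \<inter> T = N" "\<not> C \<subseteq> T"
proof -
  define F where "F = (\<lambda>X. subgroup X G \<and> X \<subseteq> L \<and> normalizes G L X \<and> N \<subset> X)"
  have "F T" using T N by (auto simp: F_def)
  then obtain C0 where C0: "F C0" and min: "\<And>X. F X \<Longrightarrow> card C0 \<le> card X"
    by (rule ex_has_least_nat[of F _ card, THEN exE]) blast
  have subL: "subgroup L G" by (rule normal_imp_subgroup[OF L])
  have subC0: "subgroup C0 G" using C0 by (simp add: F_def)
  note c = subgroup.mem_carrier[OF subC0] subgroup.mem_carrier[OF subL]
    subgroup.mem_carrier[OF normal_imp_subgroup[OF N(1)]]
  obtain g where g: "g \<in> carrier G" "\<not> conjugate G g ` C0 \<subseteq> T"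
  proof (rule ccontr)
    assume "\<not> thesis"
    then have "\<And>g. g \<in> carrier G \<Longrightarrow> conjugate G g ` C0 \<subseteq> T" using that by blast
    then have "C0 \<subseteq> N" using c by (auto intro!: core)
    then show False using C0 by (auto simp: F_def)
  qed
  define C where "C = conjugate G g ` C0"
  have subC: "subgroup C G" unfolding C_def by (rule conjugate_subgroup[OF g(1) subC0])
  have CL: "C \<subseteq> L" using C0 L g by (auto simp: C_def F_def normal_conjugate)
  have LC: "normalizes G L C"
    unfolding normalizes_def
  proof (intro ballI)
    fix l x assume l: "l \<in> L" and "x \<in> C"
    then obtain y where y: "y \<in> C0" "x = conjugate G g y" by (auto simp: C_def)
    let ?l = "conjugate G (inv g) l"
    have "?l \<in> L" using l L g by (simp add: normal_conjugate)
    then have "conjugate G ?l y \<in> C0" using C0 y by (auto simp: F_def normalizes_def)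
    moreover have "conjugate G l x = conjugate G g (conjugate G ?l y)"
    proof -
      have "l \<otimes> g = g \<otimes> ?l" using l g c by (simp add: conjugate_def m_assoc)
      then show ?thesis using l g c y by (simp add: conjugate_conjugate)
    qed
    ultimately show "conjugate G l x \<in> C" by (auto simp: C_def)
  qed
  have NC: "N \<subseteq> C"
  proof
    fix n assume n: "n \<in> N"
    then have "conjugate G (inv g) n \<in> C0" using normal_conjugate[OF N(1), of "inv g" n] g C0
      by (auto simp: F_def)
    moreover have "n = conjugate G g (conjugate G (inv g) n)" using n g c by simp
    ultimately show "n \<in> C" by (auto simp: C_def)
  qed
  have "card C = card C0"
    unfolding C_def by (meson card_image inj_conjugate[OF g(1)] inj_on_subset subgroup.subset[OF subC0])
  have "C \<inter> T = N"
  proof (rule ccontr)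
    assume "C \<inter> T \<noteq> N"
    then have "F (C \<inter> T)"
      using NC N LC T CL subC by (auto simp: F_def normalizes_Int intro: subgroups_Inter_pair)
    then have "card C \<le> card (C \<inter> T)" using min \<open>card C = card C0\<close> by simp
    then have "C \<inter> T = C"
      using card_seteq[of C "C \<inter> T"] finite_subgroup[OF fin subC] by auto
    then show False using g C_def by blast
  qed
  then show ?thesis using that subC CL LC g C_def by blast
qed

text \<open>Induction on \<open>T\<close> from above. Let \<open>N\<close> be the core of \<open>T\<close> in \<open>G\<close>, and suppose \<open>N \<noteq> T\<close>. Choose \<open>C\<close> with
  \<open>C \<inter> T = N\<close> and \<open>C\<close> not inside \<open>T\<close>, and put \<open>U = V \<inter> PC\<close>. Modulo \<open>C\<close> the group \<open>U\<close> is a \<open>\<pi>\<close>-group, since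
  \<open>P\<close> is; and \<open>V \<inter> C\<close> is a \<open>\<pi>\<close>-group modulo \<open>C \<inter> T = N\<close>, since \<open>V/T\<close> is. Hence \<open>U\<close> is a
  \<open>\<pi>\<close>-group modulo \<open>N\<close>, which is normal in \<open>G\<close>, and so \<open>U \<subseteq> PN\<close>. The induction hypothesis for \<open>TC\<close> gives
  \<open>V \<subseteq> PTC = PCT\<close>; writing \<open>v = pxt\<close>, the element \<open>vt\<^sup>-\<^sup>1 = px\<close> lies in \<open>U \<subseteq> PN\<close>, so \<open>v \<in> PT\<close>.\<close>

lemma projector_covers_section:
  assumes fin: "finite (carrier G)" and P: "modular_projector G \<pi> P" and L: "L \<lhd> G" and PL: "P \<subseteq> L"
    and "subgroup T G" "subgroup V G" "T \<subseteq> V" "V \<subseteq> L" "normalizes G L T" "normalizes G L V"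
      "pi_modulo G \<pi> V T"
  shows "V \<subseteq> P <#> T"
  using assms(5-)
proof (induction "card L - card T" arbitrary: T V rule: less_induct)
  case less
  note T = less.prems(1) and V = less.prems(2) and TV = less.prems(3) and VL = less.prems(4)
    and LT = less.prems(5) and LV = less.prems(6) and mod = less.prems(7)
  have subP: "subgroup P G" using P by (simp add: modular_projector_def)
  have subL: "subgroup L G" by (rule normal_imp_subgroup[OF L])
  define N where "N = {x \<in> carrier G. \<forall>g\<in>carrier G. conjugate G g x \<in> T}"
  have N: "N \<lhd> G" "N \<subseteq> T" using normal_core[OF T] by (simp_all add: N_def)
  show ?case
  proof (cases "N = T")
    case True
    then show ?thesis
      using pi_modulo_projector[OF P V normalizes_mono[OF LV PL] mod] N TV by simp
  next
    case False
    obtain C where C: "subgroup C G" and CL: "C \<subseteq> L" and LC: "normalizes G L C"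
      and CT: "C \<inter> T = N" "\<not> C \<subseteq> T"
      by (rule exists_complement_over_core[OF fin L T subset_trans[OF TV VL] LT N False])
        (auto simp: N_def)
    note c = subgroup.mem_carrier[OF subP] subgroup.mem_carrier[OF T] subgroup.mem_carrier[OF V]
      subgroup.mem_carrier[OF C]
    note sub = subgroup.subset[OF subP] subgroup.subset[OF T] subgroup.subset[OF V]
      subgroup.subset[OF C] subgroup.subset[OF subL]
    have PC: "subgroup (P <#> C) G"
      by (rule normalizes_product_subgroup[OF subP C normalizes_mono[OF LC PL]])
    define U where "U = V \<inter> (P <#> C)"
    have U: "subgroup U G" unfolding U_def by (rule subgroups_Inter_pair[OF V PC])
    have "U \<subseteq> P <#> N"
    proof (rule pi_modulo_projector[OF P U])
      have "normalizes G P (P <#> C)"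
        using sub PL by (intro normalizes_set_mult subgroup_normalizes_self[OF subP]
            normalizes_mono[OF LC]) auto
      then show "normalizes G P U"
        unfolding U_def by (rule normalizes_Int[OF normalizes_mono[OF LV PL]])
      have "pi_modulo G \<pi> (P <#> C) C"
        using P by (intro pi_modulo_trivial_set_mult subP C normalizes_mono[OF LC PL] pi_modulo_one)
          (auto simp: modular_projector_def)
      then have "pi_modulo G \<pi> U (C \<inter> V)"
        using subgroup_nat_pow_closed[OF V] by (fastforce simp: pi_modulo_def U_def)
      moreover have "pi_modulo G \<pi> (C \<inter> V) N"
        using mod subgroup_nat_pow_closed[OF C] unfolding CT(1)[symmetric]
        by (fastforce simp: pi_modulo_def)
      ultimately show "pi_modulo G \<pi> U N" by (rule pi_modulo_trans[OF subgroup.subset[OF U]])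
      show "N \<subseteq> U" using N TV CT(1) subset_set_mult_right[OF subP subgroup.subset[OF C]]
        by (auto simp: U_def)
    qed (rule N(1))
    have VC: "V <#> C \<subseteq> P <#> (T <#> C)"
    proof (rule less.hyps)
      have nTC: "normalizes G T C" and nVC: "normalizes G V C"
        using LC TV VL by (auto intro: normalizes_mono)
      show TC: "subgroup (T <#> C) G" by (rule normalizes_product_subgroup[OF T C nTC])
      show "subgroup (V <#> C) G" by (rule normalizes_product_subgroup[OF V C nVC])
      show "T <#> C \<subseteq> V <#> C" using TV by (intro mono_set_mult) auto
      show "V <#> C \<subseteq> L" by (rule set_mult_subset_subgroup[OF subL VL CL])
      show "normalizes G L (T <#> C)" "normalizes G L (V <#> C)"
        using sub LT LV LC by (auto intro: normalizes_set_mult)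
      show "pi_modulo G \<pi> (V <#> C) (T <#> C)" by (rule pi_modulo_set_mult[OF V C nVC mod])
      have "T \<subseteq> T <#> C" "C \<subseteq> T <#> C"
        using subset_set_mult_left[OF sub(2) C] subset_set_mult_right[OF T sub(4)] by auto
      then have "T \<subset> T <#> C" using CT(2) by auto
      moreover have "T <#> C \<subseteq> L" using set_mult_subset_subgroup[OF subL _ CL] TV VL by blast
      ultimately show "card L - card (T <#> C) < card L - card T"
        using finite_subgroup[OF fin subL] finite_subgroup[OF fin TC]
        by (meson card_mono diff_less_mono2 psubset_card_mono order_less_le_trans)
    qed
    show ?thesis
    proof
      fix v assume v: "v \<in> V"
      then have "v \<in> P <#> (T <#> C)" using VC subset_set_mult_left[OF sub(3) C] by blast
      moreover have "T <#> C = C <#> T"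
        using LC TV VL by (intro normalizes_permute T C) (auto intro: normalizes_mono)
      ultimately obtain p x t where pct: "p \<in> P" "x \<in> C" "t \<in> T" "v = p \<otimes> (x \<otimes> t)"
        by (auto elim!: set_multE)
      then have "v \<otimes> inv t = p \<otimes> x" using c by (simp add: m_assoc)
      moreover have "v \<otimes> inv t \<in> V" using v pct TV V by (auto intro: subgroup.m_closed subgroup.m_inv_closed)
      ultimately have "p \<otimes> x \<in> U" using pct by (auto simp: U_def intro: set_multI)
      then obtain p' n where p': "p' \<in> P" "n \<in> N" "p \<otimes> x = p' \<otimes> n"
        using \<open>U \<subseteq> _\<close> by (meson set_multE subsetD)
      then have "n \<in> T" using N by auto
      have "v = p' \<otimes> (n \<otimes> t)" using pct p' c \<open>n \<in> T\<close> by (simp add: m_assoc flip: m_assoc[of p x t])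
      then show "v \<in> P <#> T" using p' pct \<open>n \<in> T\<close> T by (auto intro: set_multI subgroup.m_closed)
    qed
  qed
qed


section \<open>Subgroups permuting with all conjugates of a projector\<close>

text \<open>A largest \<open>K\<close> in the family \<open>F\<close> works. For \<open>b\<close> in a conjugate \<open>Q\<close> of \<open>P\<close>, the conjugate \<open>K'\<close> of \<open>K\<close>
  under \<open>b\<close> again permutes with all conjugates of \<open>P\<close>, because conjugation by \<open>b\<close> only rearranges them.
  Hence so does the join \<open>J\<close> of \<open>K\<close> and \<open>K'\<close>. It is contained in \<open>KQ\<close>, in which \<open>K\<close> has \<open>\<pi>\<close>-index, so
  \<open>J\<close> belongs to \<open>F\<close> and equals \<open>K\<close>.\<close>

lemma permuting_overgroup:
  assumes fin: "finite (carrier G)" and H: "subgroup H G" and P: "subgroup P G" "pi_number \<pi> (card P)"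
    and perm: "\<And>g. g \<in> carrier G \<Longrightarrow> H <#> conjugate G g ` P = conjugate G g ` P <#> H"
  obtains K where "subgroup K G" "H \<subseteq> K" "pi_index \<pi> K H"
    "\<And>g. g \<in> carrier G \<Longrightarrow> normalizes G (conjugate G g ` P) K"
proof -
  define F where "F = (\<lambda>K. subgroup K G \<and> H \<subseteq> K \<and> pi_index \<pi> K H \<and>
    (\<forall>g\<in>carrier G. K <#> conjugate G g ` P = conjugate G g ` P <#> K))"
  have "F H" using H perm by (auto simp: F_def pi_index_refl)
  moreover have "\<forall>K. F K \<longrightarrow> card K \<le> card (carrier G)"
    using fin by (auto simp: F_def intro: card_mono dest: subgroup.subset)
  ultimately obtain K where K: "F K" and max: "\<And>X. F X \<Longrightarrow> card X \<le> card K"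
    using ex_has_greatest_nat[of F H card] by (metis order.strict_trans2 le_imp_less_Suc)
  have subK: "subgroup K G" using K by (simp add: F_def)
  note cK = subgroup.mem_carrier[OF subK] and cP = subgroup.mem_carrier[OF P(1)]
  have "normalizes G (conjugate G g ` P) K" if g: "g \<in> carrier G" for g
    unfolding normalizes_def
  proof (intro ballI)
    let ?Q = "conjugate G g ` P"
    fix b k assume b: "b \<in> ?Q" and k: "k \<in> K"
    have Q: "subgroup ?Q G" by (rule conjugate_subgroup[OF g P(1)])
    have bc: "b \<in> carrier G" using b Q by (simp add: subgroup.mem_carrier)
    define K' where "K' = conjugate G b ` K"
    have K': "subgroup K' G" unfolding K'_def by (rule conjugate_subgroup[OF bc subK])
    have KQ: "K <#> ?Q = ?Q <#> K" using K g by (simp add: F_def)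
    have subKQ: "subgroup (K <#> ?Q) G" by (rule permute_subgroup[OF subK Q KQ])
    have KK': "K \<union> K' \<subseteq> carrier G" using cK bc by (auto simp: K'_def)
    let ?J = "generate G (K \<union> K')"
    have J: "subgroup ?J G" by (rule generate_is_subgroup[OF KK'])
    have K_KQ: "K \<subseteq> K <#> ?Q" by (rule subset_set_mult_left[OF subgroup.subset[OF subK] Q])
    have Q_KQ: "?Q \<subseteq> K <#> ?Q" by (rule subset_set_mult_right[OF subK subgroup.subset[OF Q]])
    have "K' \<subseteq> K <#> ?Q"
      using subgroup_normalizes_self[OF subKQ] K_KQ Q_KQ b by (force simp: K'_def normalizes_def)
    then have J_KQ: "?J \<subseteq> K <#> ?Q" using K_KQ by (intro generate_subgroup_incl[OF _ subKQ]) auto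
    have "K \<subseteq> ?J" by (auto intro: generate.incl)
    have "F ?J"
      unfolding F_def
    proof (intro conjI ballI)
      show "H \<subseteq> ?J" using K \<open>K \<subseteq> ?J\<close> by (auto simp: F_def)
      have "card ?Q = card P"
        using inj_conjugate[OF g] P(1) by (meson card_image inj_on_subset subgroup.subset)
      then have "pi_index \<pi> (K <#> ?Q) K"
        using P(2) by (intro pi_index_set_mult[OF fin subK Q KQ]) simp
      then have "pi_index \<pi> ?J K" by (rule pi_index_tower[OF fin subK J subKQ \<open>K \<subseteq> ?J\<close> J_KQ])
      then show "pi_index \<pi> ?J H" using K pi_index_trans by (auto simp: F_def)
      fix h assume h: "h \<in> carrier G"
      let ?S = "conjugate G h ` P"
      have S: "subgroup ?S G" by (rule conjugate_subgroup[OF h P(1)])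
      (* the conjugate of P under h is the image under b of the one under inv b h *)
      have "K <#> conjugate G (inv b \<otimes> h) ` P = conjugate G (inv b \<otimes> h) ` P <#> K"
        using K h bc by (simp add: F_def)
      then have "conjugate G b ` (K <#> conjugate G (inv b \<otimes> h) ` P)
        = conjugate G b ` (conjugate G (inv b \<otimes> h) ` P <#> K)" by simp
      moreover have img: "conjugate G b ` (X <#> Y) = conjugate G b ` X <#> conjugate G b ` Y"
        if "X \<subseteq> carrier G" "Y \<subseteq> carrier G" for X Y
        using set_mult_hom[OF group_hom.homh[OF conjugate_hom[OF bc]] that] .
      moreover have "conjugate G b ` conjugate G (inv b \<otimes> h) ` P = ?S"
        unfolding image_image
        by (rule image_cong) (use bc h cP in \<open>auto simp: conjugate_conjugate\<close>)
      moreover have "conjugate G (inv b \<otimes> h) ` P \<subseteq> carrier G" "K \<subseteq> carrier G"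
        using bc h cP cK by auto
      ultimately have "K' <#> ?S = ?S <#> K'" by (simp add: K'_def)
      then show "?J <#> ?S = ?S <#> ?J"
        using K h by (intro generate_permute subK K' S) (auto simp: F_def)
    qed (rule J)
    then have "?J = K"
      using max card_seteq[OF finite_subgroup[OF fin J] \<open>K \<subseteq> ?J\<close>] by auto
    moreover have "conjugate G b k \<in> ?J" using k by (auto simp: K'_def intro: generate.incl)
    ultimately show "conjugate G b k \<in> K" by simp
  qed
  then show ?thesis using that K by (auto simp: F_def)
qed

lemma primary_elements_conjugate:
  assumes "x \<in> primary_elements G \<pi>" "g \<in> carrier G"
  shows "conjugate G g x \<in> primary_elements G \<pi>"
proof -
  obtain q n where "x \<in> carrier G" "prime q" "q \<in> \<pi>" "x [^] (q ^ n :: nat) = \<one>"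
    using assms(1) by (auto simp: primary_elements_def)
  moreover from this have "conjugate G g x [^] (q ^ n) = \<one>"
    using assms(2) by (metis conjugate_one conjugate_pow)
  ultimately show ?thesis using assms(2) unfolding primary_elements_def by blast
qed

lemma primary_elements_subset: "primary_elements G \<pi> \<subseteq> carrier G"
  by (auto simp: primary_elements_def)

lemma primary_subgroup_normal: "primary_subgroup G \<pi> \<lhd> G"
  using primary_elements_conjugate
  by (intro normal_generateI primary_elements_subset) (simp add: conjugate_def)

lemma card_generate_primary:
  assumes "x \<in> carrier G" "prime q" "x [^] (q ^ n :: nat) = \<one>"
  shows "pi_number {q} (card (generate G {x}))"
proof -
  have "card (generate G {x}) dvd q ^ n"
    using assms by (simp add: pow_eq_id flip: generate_pow_card)
  then show ?thesis using pi_number_prime_power[OF assms(2), of "{q}" n] by (auto intro: pi_number_dvd)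
qed

text \<open>A primary \<open>\<pi>\<close>-element \<open>x\<close> generates a \<open>\<pi>\<close>-group modulo \<open>M\<close>, but the image \<open>PM/M\<close> of \<open>P\<close> is trivial and
  at the same time a maximal \<open>\<pi>\<close>-subgroup of \<open>G/M\<close>; so \<open>x \<in> M\<close>.\<close>

lemma primary_subgroup_le_normal:
  assumes P: "modular_projector G \<pi> P" and M: "M \<lhd> G" "P \<subseteq> M"
  shows "primary_subgroup G \<pi> \<subseteq> M"
proof (rule generate_subgroup_incl[OF _ normal_imp_subgroup[OF M(1)]])
  have subM: "subgroup M G" by (rule normal_imp_subgroup[OF M(1)])
  show "primary_elements G \<pi> \<subseteq> M"
  proof
    fix x assume "x \<in> primary_elements G \<pi>"
    then obtain q n where x: "x \<in> carrier G" "prime q" "q \<in> \<pi>" "x [^] (q ^ n) = \<one>"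
      by (auto simp: primary_elements_def)
    let ?X = "generate G {x}"
    have X: "subgroup ?X G" using x by (intro generate_is_subgroup) auto
    have nXM: "normalizes G ?X M"
      using X M by (auto simp: normalizes_def normal_conjugate subgroup.mem_carrier)
    have "pi_number \<pi> (card ?X)"
      using card_generate_primary[OF x(1,2,4)] x(3) by (auto simp: pi_number_def)
    then have mod: "pi_modulo G \<pi> (?X <#> M) M"
      by (intro pi_modulo_trivial_set_mult X subM nXM pi_modulo_one)
    have "M \<subseteq> ?X <#> M" by (rule subset_set_mult_right[OF X subgroup.subset[OF subM]])
    then have "?X <#> M \<subseteq> P <#> M"
      using M(2) mod normalizes_product_subgroup[OF X subM nXM]
      by (intro modular_projectorD[OF P M(1)]) auto
    also have "\<dots> \<subseteq> M" by (rule set_mult_subset_subgroup[OF subM M(2)]) simp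
    finally have "?X <#> M \<subseteq> M" .
    moreover have "x \<in> ?X" by (auto intro: generate.incl)
    ultimately show "x \<in> M" using subset_set_mult_left[OF subgroup.subset[OF X] subM] by blast
  qed
qed

lemma pi_subgroup_le_primary_subgroup:
  assumes fin: "finite (carrier G)" and P: "subgroup P G" "pi_number \<pi> (card P)"
  shows "P \<subseteq> primary_subgroup G \<pi>"
proof
  fix x assume x: "x \<in> P"
  then have xc: "x \<in> carrier G" using P by (simp add: subgroup.mem_carrier)
  have L: "subgroup (primary_subgroup G \<pi>) G" by (rule generate_is_subgroup[OF primary_elements_subset])
  obtain m where m: "pi_number (- \<pi>) m" "x [^] m \<in> primary_subgroup G \<pi>"
    using exists_pi_pow_mem[OF fin L xc, of "- \<pi>"] by (auto intro: generate.incl)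
  moreover have "x [^] card P \<in> primary_subgroup G \<pi>"
    using pow_card_eq_one[OF P(1) x] generate.one by simp
  moreover have "coprime m (card P)" by (rule pi_number_coprime[OF m(1) P(2)]) auto
  ultimately show "x \<in> primary_subgroup G \<pi>" using coprime_pow_mem[OF L xc] by blast
qed

lemma permuting_overgroup_primary:
  assumes fin: "finite (carrier G)" and H: "subgroup H G" and P: "modular_projector G \<pi> P"
    and perm: "\<And>g. g \<in> carrier G \<Longrightarrow> H <#> conjugate G g ` P = conjugate G g ` P <#> H"
  obtains K where "subgroup K G" "H \<subseteq> K" "pi_index \<pi> K H" "normalizes G (primary_subgroup G \<pi>) K"
proof -
  have subP: "subgroup P G" and cardP: "pi_number \<pi> (card P)" using P by (auto simp: modular_projector_def)
  obtain K where K: "subgroup K G" "H \<subseteq> K" "pi_index \<pi> K H"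
    and norm: "\<And>g. g \<in> carrier G \<Longrightarrow> normalizes G (conjugate G g ` P) K"
    using permuting_overgroup[OF fin H subP cardP perm] by metis
  define S where "S = (\<Union>g\<in>carrier G. conjugate G g ` P)"
  note c = subgroup.mem_carrier[OF subP]
  have S: "S \<subseteq> carrier G" using c by (auto simp: S_def)
  have "generate G S \<lhd> G"
  proof (rule normal_generateI[OF S])
    fix h g assume "h \<in> S" and g: "g \<in> carrier G"
    then obtain y p where y: "y \<in> carrier G" "p \<in> P" "h = conjugate G y p" by (auto simp: S_def)
    then have "conjugate G g h = conjugate G (g \<otimes> y) p" using g c by (simp add: conjugate_conjugate)
    then show "g \<otimes> h \<otimes> inv g \<in> S" using g y by (auto simp: S_def conjugate_def[symmetric])
  qed
  moreover have "P \<subseteq> generate G S"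
  proof
    fix p assume "p \<in> P"
    then have "conjugate G \<one> p \<in> S" unfolding S_def by blast
    then show "p \<in> generate G S" using \<open>p \<in> P\<close> c by (simp add: generate.incl)
  qed
  ultimately have "primary_subgroup G \<pi> \<subseteq> generate G S" by (rule primary_subgroup_le_normal[OF P])
  moreover have "normalizes G (generate G S) K"
    using norm by (intro normalizes_generate[OF fin K(1) S]) (auto simp: normalizes_def S_def)
  ultimately show ?thesis using that K normalizes_mono by blast
qed

end

section \<open>Sandwiched subgroups\<close>

definition sandwiched :: "('a, 'b) monoid_scheme \<Rightarrow> nat set \<Rightarrow> 'a set \<Rightarrow> bool" where
  "sandwiched G \<pi> H \<longleftrightarrow> (\<exists>R K. subgroup R G \<and> subgroup K G \<and> R \<subseteq> H \<and> H \<subseteq> K \<and>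
     normalizes G (primary_subgroup G \<pi>) R \<and>
     normalizes G (primary_subgroup G \<pi>) K \<and> pi_modulo G \<pi> K R)"

context group
begin

lemma sandwiched_Int:
  assumes "sandwiched G \<pi> A" "sandwiched G \<pi> B"
  shows "sandwiched G \<pi> (A \<inter> B)"
proof -
  let ?L = "primary_subgroup G \<pi>"
  obtain R K where 1: "subgroup R G" "subgroup K G" "R \<subseteq> A" "A \<subseteq> K" "normalizes G ?L R"
    "normalizes G ?L K" "pi_modulo G \<pi> K R" using assms(1) by (auto simp: sandwiched_def)
  obtain S M where 2: "subgroup S G" "subgroup M G" "S \<subseteq> B" "B \<subseteq> M" "normalizes G ?L S"
    "normalizes G ?L M" "pi_modulo G \<pi> M S" using assms(2) by (auto simp: sandwiched_def)
  show ?thesis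
    unfolding sandwiched_def
    using 1 2
    by (intro exI[of _ "R \<inter> S"] exI[of _ "K \<inter> M"] conjI subgroups_Inter_pair normalizes_Int
        pi_modulo_Int[OF subgroup.subset[OF 1(2)]]) auto
qed

text \<open>The point is \<open>HP = RP\<close>. The part of \<open>K\<close> inside \<open>L\<close> is covered by \<open>RP\<close>, by the result on sections of
  \<open>L\<close>. An arbitrary \<open>h \<in> H\<close> has a power with \<open>\<pi>\<close>-number exponent in \<open>R\<close>, and a power with
  \<open>\<pi>'\<close>-number exponent in \<open>K \<inter> L\<close>; both lie in \<open>RP\<close>, and the exponents are coprime.\<close>

lemma sandwiched_permutes:
  assumes fin: "finite (carrier G)" and "sandwiched G \<pi> H" and P: "modular_projector G \<pi> P"
  shows "H <#> P = P <#> H"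
proof -
  let ?L = "primary_subgroup G \<pi>"
  obtain R K where R: "subgroup R G" and K: "subgroup K G" and RH: "R \<subseteq> H" and HK: "H \<subseteq> K"
    and LR: "normalizes G ?L R" and LK: "normalizes G ?L K" and mod: "pi_modulo G \<pi> K R"
    using assms(2) by (auto simp: sandwiched_def)
  have subP: "subgroup P G" and cardP: "pi_number \<pi> (card P)" using P by (auto simp: modular_projector_def)
  have PL: "P \<subseteq> ?L" by (rule pi_subgroup_le_primary_subgroup[OF fin subP cardP])
  have L: "subgroup ?L G" by (rule generate_is_subgroup[OF primary_elements_subset])
  note c = subgroup.mem_carrier[OF R] subgroup.mem_carrier[OF K] subgroup.mem_carrier[OF subP]
  have RP: "R <#> P = P <#> R"
    using normalizes_permute[OF subP R normalizes_mono[OF LR PL]] by simp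
  have "K \<inter> ?L \<subseteq> P <#> (R \<inter> ?L)"
  proof (rule projector_covers_section[OF fin P primary_subgroup_normal PL])
    show "subgroup (R \<inter> ?L) G" "subgroup (K \<inter> ?L) G"
      using R K L by (auto intro: subgroups_Inter_pair)
    show "normalizes G ?L (R \<inter> ?L)" "normalizes G ?L (K \<inter> ?L)"
      using LR LK subgroup_normalizes_self[OF L] by (auto intro: normalizes_Int)
    show "pi_modulo G \<pi> (K \<inter> ?L) (R \<inter> ?L)"
      unfolding pi_modulo_def
    proof
      fix x assume x: "x \<in> K \<inter> ?L"
      then obtain m where "pi_number \<pi> m" "x [^] m \<in> R" using mod by (auto simp: pi_modulo_def)
      moreover have "x [^] m \<in> ?L" using x by (intro subgroup_nat_pow_closed[OF L]) simp
      ultimately show "\<exists>m. pi_number \<pi> m \<and> x [^] m \<in> R \<inter> ?L" by blast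
    qed
  qed (use RH HK in auto)
  then have KL: "K \<inter> ?L \<subseteq> R <#> P" unfolding RP by (blast intro: subsetD[OF mono_set_mult])
  have H_RP: "H \<subseteq> R <#> P"
  proof
    fix h assume "h \<in> H"
    then have h: "h \<in> K" "h \<in> carrier G" using HK c by auto
    obtain m where m: "pi_number \<pi> m" "h [^] m \<in> R" using mod h by (auto simp: pi_modulo_def)
    obtain n where n: "pi_number (- \<pi>) n" "h [^] n \<in> ?L"
      using exists_pi_pow_mem[OF fin L h(2), of "- \<pi>"] by (auto intro: generate.incl)
    have RP_sub: "subgroup (R <#> P) G" by (rule permute_subgroup[OF R subP RP])
    have "h [^] m \<in> R <#> P" using m subset_set_mult_left[OF subgroup.subset[OF R] subP] by blast
    moreover have "h [^] n \<in> R <#> P" using n KL subgroup_nat_pow_closed[OF K h(1)] by blast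
    moreover have "coprime m n" by (rule pi_number_coprime[OF m(1) n(1)]) auto
    ultimately show "h \<in> R <#> P" by (rule coprime_pow_mem[OF RP_sub h(2)])
  qed
  have sub: "subgroup (R <#> P) G" by (rule permute_subgroup[OF R subP RP])
  have P_RP: "P \<subseteq> R <#> P" by (rule subset_set_mult_right[OF R subgroup.subset[OF subP]])
  have "H <#> P = R <#> P"
  proof
    show "H <#> P \<subseteq> R <#> P" by (rule set_mult_subset_subgroup[OF sub H_RP P_RP])
    show "R <#> P \<subseteq> H <#> P" by (rule mono_set_mult[OF RH subset_refl])
  qed
  moreover have "P <#> H = R <#> P"
  proof
    show "P <#> H \<subseteq> R <#> P" by (rule set_mult_subset_subgroup[OF sub P_RP H_RP])
    show "R <#> P \<subseteq> P <#> H" unfolding RP by (rule mono_set_mult[OF subset_refl RH])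
  qed
  ultimately show ?thesis by simp
qed

text \<open>This uses all cells at once: the overgroups of \<open>H\<close> belonging to two different cells meet exactly in
  \<open>H\<close>, and each of them is normalized by the primary elements of its own cell. The lower group \<open>R\<close> is generated
  by the primary \<open>\<pi>'\<close>-elements of \<open>K\<close>; everything that normalizes \<open>K\<close> normalizes it.\<close>

lemma sandwiched_if_permuting:
  assumes fin: "finite (carrier G)" and H: "subgroup H G"
    and disj: "\<And>\<pi> \<tau>. \<pi> \<in> \<sigma> \<Longrightarrow> \<tau> \<in> \<sigma> \<Longrightarrow> \<pi> \<noteq> \<tau> \<Longrightarrow> \<pi> \<inter> \<tau> = {}" and cover: "\<And>q. prime q \<Longrightarrow> q \<in> \<Union>\<sigma>"
    and perm: "\<And>\<pi>. \<pi> \<in> \<sigma> \<Longrightarrow> \<exists>P. modular_projector G \<pi> P \<and>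
      (\<forall>g\<in>carrier G. H <#> conjugate G g ` P = conjugate G g ` P <#> H)"
    and \<pi>: "\<pi> \<in> \<sigma>"
  shows "sandwiched G \<pi> H"
proof -
  have over: "\<exists>K. subgroup K G \<and> H \<subseteq> K \<and> pi_index \<tau> K H \<and> normalizes G (primary_subgroup G \<tau>) K"
    if "\<tau> \<in> \<sigma>" for \<tau>
    using perm[OF that] permuting_overgroup_primary[OF fin H] by metis
  obtain K where K: "subgroup K G" and HK: "H \<subseteq> K" and KH: "pi_index \<pi> K H"
    and LK: "normalizes G (primary_subgroup G \<pi>) K"
    using over[OF \<pi>] by blast
  let ?E = "K \<inter> primary_elements G (- \<pi>)"
  define R where "R = generate G ?E"
  have E: "?E \<subseteq> carrier G" using K by (auto simp: subgroup.mem_carrier)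
  have R: "subgroup R G" unfolding R_def by (rule generate_is_subgroup[OF E])
  have "?E \<subseteq> H"
  proof
    fix x assume x: "x \<in> ?E"
    then obtain q n where q: "prime q" "q \<notin> \<pi>" "x [^] (q ^ n) = \<one>" and xc: "x \<in> carrier G"
      by (auto simp: primary_elements_def)
    obtain \<tau> where \<tau>: "\<tau> \<in> \<sigma>" "q \<in> \<tau>" using cover[OF q(1)] by blast
    then have "\<pi> \<inter> \<tau> = {}" using disj[OF \<pi>] q(2) by blast
    obtain M where M: "subgroup M G" and HM: "H \<subseteq> M" and MH: "pi_index \<tau> M H"
      and LM: "normalizes G (primary_subgroup G \<tau>) M"
      using over[OF \<tau>(1)] by blast
    have KM: "subgroup (K \<inter> M) G" by (rule subgroups_Inter_pair[OF K M])
    have "K \<inter> M = H"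
    proof (rule pi_index_disjoint_eq[OF fin H KM _ _ _ \<open>\<pi> \<inter> \<tau> = {}\<close>])
      show "pi_index \<pi> (K \<inter> M) H" by (rule pi_index_tower[OF fin H KM K]) (use HK HM KH in auto)
      show "pi_index \<tau> (K \<inter> M) H" by (rule pi_index_tower[OF fin H KM M]) (use HK HM MH in auto)
    qed (use HK HM in auto)
    let ?X = "generate G {x}"
    have X: "subgroup ?X G" using xc by (intro generate_is_subgroup) auto
    have "x \<in> primary_subgroup G \<tau>"
      using q xc \<tau> by (intro generate.incl) (auto simp: primary_elements_def)
    then have "normalizes G {x} M" using LM by (auto simp: normalizes_def)
    moreover have "normalizes G {x} K"
      using x by (intro normalizes_mono[OF subgroup_normalizes_self[OF K]]) auto
    ultimately have "normalizes G {x} H"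
      using normalizes_Int \<open>K \<inter> M = H\<close> by metis
    then have nXH: "normalizes G ?X H" using xc by (intro normalizes_generate[OF fin H]) auto
    then have HX: "H <#> ?X = ?X <#> H" using normalizes_permute[OF X H] by simp
    have HXs: "subgroup (H <#> ?X) G" by (rule permute_subgroup[OF H X HX])
    have "?X \<subseteq> K" using x K by (intro generate_subgroup_incl) auto
    then have "H <#> ?X \<subseteq> K" by (rule set_mult_subset_subgroup[OF K HK])
    moreover have H_HX: "H \<subseteq> H <#> ?X" by (rule subset_set_mult_left[OF subgroup.subset[OF H] X])
    ultimately have "pi_index \<pi> (H <#> ?X) H" using pi_index_tower[OF fin H HXs K] KH by blast
    moreover have "pi_index {q} (H <#> ?X) H"
      by (rule pi_index_set_mult[OF fin H X HX card_generate_primary[OF xc q(1,3)]])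
    ultimately have "H <#> ?X = H" using pi_index_disjoint_eq[OF fin H HXs H_HX] q(2) by blast
    moreover have "x \<in> ?X" by (auto intro: generate.incl)
    ultimately show "x \<in> H" using subset_set_mult_right[OF H subgroup.subset[OF X]] by blast
  qed
  then have RH: "R \<subseteq> H" unfolding R_def by (rule generate_subgroup_incl[OF _ H])
  have L: "subgroup (primary_subgroup G \<pi>) G" by (rule generate_is_subgroup[OF primary_elements_subset])
  have LR: "normalizes G (primary_subgroup G \<pi>) R"
    unfolding normalizes_def
  proof (intro ballI)
    fix l x assume l: "l \<in> primary_subgroup G \<pi>" and "x \<in> R"
    have lc: "l \<in> carrier G" using l L by (simp add: subgroup.mem_carrier)
    have "conjugate G l ` ?E \<subseteq> ?E"
      using LK l lc by (auto simp: normalizes_def intro: primary_elements_conjugate)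
    then have "generate G (conjugate G l ` ?E) \<subseteq> R" unfolding R_def by (rule mono_generate)
    then have "conjugate G l ` R \<subseteq> R"
      unfolding R_def using group_hom.generate_img[OF conjugate_hom[OF lc] E] by simp
    then show "conjugate G l x \<in> R" using \<open>x \<in> R\<close> by blast
  qed
  have "pi_modulo G \<pi> K R"
    unfolding pi_modulo_def
  proof
    fix x assume x: "x \<in> K"
    then have "x [^] k \<in> R" if "x [^] (k::nat) \<in> primary_elements G (- \<pi>)" for k
      using that subgroup_nat_pow_closed[OF K x] unfolding R_def by (intro generate.incl) auto
    then show "\<exists>m. pi_number \<pi> m \<and> x [^] m \<in> R"
      using x K by (intro exists_pi_pow_mem[OF fin R]) (auto simp: subgroup.mem_carrier)
  qed
  then show ?thesis using R K RH HK LR LK unfolding sandwiched_def by blast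
qed

lemma sigma3_permutable_imp_sandwiched:
  assumes fin: "finite (carrier G)" and part: "prime_partition I \<pi>"
    and H: "sigma3_permutable (\<pi> ` I) G H" and i: "i \<in> I"
  shows "sandwiched G (\<pi> i) H"
proof (rule sandwiched_if_permuting[OF fin, where \<sigma> = "\<pi> ` I"])
  show "subgroup H G" using H by (simp add: sigma3_permutable_def)
  show "\<rho> \<inter> \<tau> = {}" if cells: "\<rho> \<in> \<pi> ` I" "\<tau> \<in> \<pi> ` I" "\<rho> \<noteq> \<tau>" for \<rho> \<tau>
  proof -
    obtain j k where "j \<in> I" "k \<in> I" "\<rho> = \<pi> j" "\<tau> = \<pi> k" using cells by blast
    moreover from this have "j \<noteq> k" using cells by blast
    ultimately show ?thesis using part by (simp add: prime_partition_def disjoint_family_on_def)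
  qed
  show "q \<in> \<Union> (\<pi> ` I)" if "prime q" for q using that part by (auto simp: prime_partition_def)
  show "\<exists>P. modular_projector G \<rho> P \<and> (\<forall>g\<in>carrier G. H <#> conjugate G g ` P = conjugate G g ` P <#> H)"
    if \<rho>: "\<rho> \<in> \<pi> ` I" for \<rho>
  proof -
    obtain P where P: "pi_projector \<rho> G P"
      and perm: "\<And>x. x \<in> carrier G \<Longrightarrow> H <#> conj_subgroup G P x = conj_subgroup G P x <#> H"
      using H \<rho> by (auto simp: sigma3_permutable_def)
    have mp: "modular_projector G \<rho> P" by (rule pi_projector_modular[OF fin P])
    then have "P \<subseteq> carrier G" by (simp add: modular_projector_def subgroup.subset)
    then have "H <#> conjugate G g ` P = conjugate G g ` P <#> H" if "g \<in> carrier G" for g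
      using perm[of "inv g"] that by (simp add: conj_subgroup_eq)
    then show ?thesis using mp by blast
  qed
qed (use i in blast)

lemma sandwiched_permutes_conj_subgroup:
  assumes "finite (carrier G)" "sandwiched G \<pi> H" "pi_projector \<pi> G P" "x \<in> carrier G"
  shows "H <#> conj_subgroup G P x = conj_subgroup G P x <#> H"
proof -
  have P: "modular_projector G \<pi> P" by (rule pi_projector_modular[OF assms(1,3)])
  then have "P \<subseteq> carrier G" by (simp add: modular_projector_def subgroup.subset)
  then have "conj_subgroup G P x = conjugate G (inv x) ` P" using assms(4) by (rule_tac conj_subgroup_eq)
  then show ?thesis
    using sandwiched_permutes[OF assms(1,2) modular_projector_conjugate[OF P]] assms(4) by simp
qed

end

theorem theorem4:
  fixes G :: "('a, 'b) monoid_scheme"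
    and I :: "'i set"
    and \<pi> :: "'i \<Rightarrow> nat set"
    and A B :: "'a set"
  assumes "group G" and "finite (carrier G)"
    and "prime_partition I \<pi>"
    and "sigma3_permutable (\<pi> ` I) G A"
    and "sigma3_permutable (\<pi> ` I) G B"
  shows "sigma3_permutable (\<pi> ` I) G (A \<inter> B) \<and>
    sigma3_permutable (\<pi> ` I) G (generate G (A \<union> B))"
proof -
  interpret group G by fact
  note fin = assms(2)
  have A: "subgroup A G" and B: "subgroup B G" using assms(4,5) by (auto simp: sigma3_permutable_def)
  have J: "subgroup (generate G (A \<union> B)) G"
    using A B by (intro generate_is_subgroup) (auto simp: subgroup.mem_carrier)
  have both: "\<exists>P. pi_projector \<rho> G P \<and> (\<forall>x\<in>carrier G.
      (A \<inter> B) <#>\<^bsub>G\<^esub> conj_subgroup G P x = conj_subgroup G P x <#>\<^bsub>G\<^esub> (A \<inter> B) \<and>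
      generate G (A \<union> B) <#>\<^bsub>G\<^esub> conj_subgroup G P x = conj_subgroup G P x <#>\<^bsub>G\<^esub> generate G (A \<union> B))"
    if \<rho>: "\<rho> \<in> \<pi> ` I" for \<rho>
  proof -
    have sA: "sandwiched G \<rho> A" and sB: "sandwiched G \<rho> B"
      using \<rho> sigma3_permutable_imp_sandwiched[OF fin assms(3)] assms(4,5) by auto
    obtain P where P: "pi_projector \<rho> G P" using assms(4) \<rho> by (auto simp: sigma3_permutable_def)
    note perm = sandwiched_permutes_conj_subgroup[OF fin _ P]
    have subP: "subgroup P G" using P by (simp add: pi_projector_def)
    show ?thesis
    proof (intro exI[of _ P] conjI ballI P)
      fix x assume x: "x \<in> carrier G"
      show "(A \<inter> B) <#>\<^bsub>G\<^esub> conj_subgroup G P x = conj_subgroup G P x <#>\<^bsub>G\<^esub> (A \<inter> B)"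
        by (rule perm[OF sandwiched_Int[OF sA sB] x])
      have "subgroup (conj_subgroup G P x) G"
        using x subP by (simp add: conj_subgroup_eq subgroup.subset conjugate_subgroup)
      then show "generate G (A \<union> B) <#>\<^bsub>G\<^esub> conj_subgroup G P x = conj_subgroup G P x <#>\<^bsub>G\<^esub> generate G (A \<union> B)"
        using perm[OF sA x] perm[OF sB x] by (intro generate_permute A B)
    qed
  qed
  then show ?thesis
    using subgroups_Inter_pair[OF A B] J unfolding sigma3_permutable_def by meson
qed

end
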